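(* The function $$\mathcal{B}_{H^+}(x,y)=\frac1\pi(x^2+2{\rm Re}(y)x+|y|^2)^{-2}(x^2+2xy+y^2)$$ is the reproducing kernel for the slice Bergman space $\mathcal{A}(H^+(\mathbb{O}))$ of the right half-space $H^+(\mathbb{O})=\{x\in\mathbb{O}:{\rm Re}(x)>0\}$. For $d>0$, the function $$\mathcal{B}_T(x,y)=\sum_{n=-\infty}^{+\infty}\frac1\pi(x^2+2{\rm Re}(2dn+y)x+|2dn+y|^2)^{-2}(x^2+2x(2dn+y)+(2dn+y)^2)$$ is the reproducing kernel for the slice Bergman space $\mathcal{A}(T)$ of the strip $T=\{x\in\mathbb{O}:0<{\rm Re}(x)<d\}$.
   Context: $\mathbb{O}\cong\mathbb{R}^8$ denotes the (non-associative) octonions with conjugation $x\mapsto\bar{x}$, real part ${\rm Re}(x)$ and norm $|x|=\sqrt{x\bar{x}}$. $\mathbb{S}$ is the sphere of purely imaginary unit octonions and $\mathbb{C}_I=\mathbb{R}+\mathbb{R}I$ for $I\in\mathbb{S}$. A real differentiable $f:\Omega\to\mathbb{O}$ is slice monogenic if for every $I\in\mathbb{S}$ its restriction $f_I$ to $\Omega_I=\Omega\cap\mathbb{C}_I$ satisfies $\frac12(\frac{\partial}{\partial u}+I\frac{\partial}{\partial v})f_I(u+Iv)=0$. For $\Omega=H^+(\mathbb{O})$ or $\Omega=T$, $\mathcal{A}(\Omega)$ is the set of slice monogenic $f$ on $\Omega$ such that $\int_{\Omega_I}|f_I|^2\,du\,dv<\infty$ for some $I\in\mathbb{S}$ (equivalently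 for all $I$), and $\langle f,g\rangle_I=\int_{\Omega_I}\overline{g(y)}f(y)\,du\,dv$, $y=u+Iv$. "Reproducing kernel" means that for every $f\in\mathcal{A}(\Omega)$, every $I\in\mathbb{S}$ and every $x\in\Omega_I$ one has $\langle f,\mathcal{B}_\Omega(\cdot,x)\rangle_I=\int_{\Omega_I}\overline{\mathcal{B}_\Omega(y,x)}\,f(y)\,du\,dv=f(x)$, where $\mathcal{B}_\Omega$ is $\mathcal{B}_{H^+}$ or $\mathcal{B}_T$ respectively; the values of $f$ off $\mathbb{C}_I$ are then determined by those on $\mathbb{C}_I$ through the Representation Formula $f(u+Jv)=\frac12[f(u+Iv)+f(u-Iv)]+\frac12J[I(f(u-Iv)-f(u+Iv))]$, $J\in\mathbb{S}$. *)

theory Defs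
  imports "HOL-Analysis.Analysis"
begin

codatatype octonion = Octonion
  (oRe: real)
  (oIm1: real) (oIm2: real) (oIm3: real)
  (oIm4: real) (oIm5: real) (oIm6: real) (oIm7: real)

lemma octonion_eq_iff:
  "x = y \<longleftrightarrow>
     oRe x = oRe y \<and> oIm1 x = oIm1 y \<and> oIm2 x = oIm2 y \<and> oIm3 x = oIm3 y \<and>
     oIm4 x = oIm4 y \<and> oIm5 x = oIm5 y \<and> oIm6 x = oIm6 y \<and> oIm7 x = oIm7 y"
  using octonion.expand by blast

instantiation octonion :: ab_group_add
begin

primcorec zero_octonion :: octonion where
  "oRe 0 = 0"
| "oIm1 0 = 0"
| "oIm2 0 = 0"
| "oIm3 0 = 0"
| "oIm4 0 = 0"
| "oIm5 0 = 0"
| "oIm6 0 = 0"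
| "oIm7 0 = 0"

primcorec plus_octonion :: "octonion \<Rightarrow> octonion \<Rightarrow> octonion" where
  "oRe (x + y) = oRe x + oRe y"
| "oIm1 (x + y) = oIm1 x + oIm1 y"
| "oIm2 (x + y) = oIm2 x + oIm2 y"
| "oIm3 (x + y) = oIm3 x + oIm3 y"
| "oIm4 (x + y) = oIm4 x + oIm4 y"
| "oIm5 (x + y) = oIm5 x + oIm5 y"
| "oIm6 (x + y) = oIm6 x + oIm6 y"
| "oIm7 (x + y) = oIm7 x + oIm7 y"

primcorec uminus_octonion :: "octonion \<Rightarrow> octonion" where
  "oRe (- x) = - oRe x"
| "oIm1 (- x) = - oIm1 x"
| "oIm2 (- x) = - oIm2 x"
| "oIm3 (- x) = - oIm3 x"
| "oIm4 (- x) = - oIm4 x"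
| "oIm5 (- x) = - oIm5 x"
| "oIm6 (- x) = - oIm6 x"
| "oIm7 (- x) = - oIm7 x"

primcorec minus_octonion :: "octonion \<Rightarrow> octonion \<Rightarrow> octonion" where
  "oRe (x - y) = oRe x - oRe y"
| "oIm1 (x - y) = oIm1 x - oIm1 y"
| "oIm2 (x - y) = oIm2 x - oIm2 y"
| "oIm3 (x - y) = oIm3 x - oIm3 y"
| "oIm4 (x - y) = oIm4 x - oIm4 y"
| "oIm5 (x - y) = oIm5 x - oIm5 y"
| "oIm6 (x - y) = oIm6 x - oIm6 y"
| "oIm7 (x - y) = oIm7 x - oIm7 y"

instance
  by standard (simp_all add: octonion_eq_iff)

end

text \<open>
  The units \<open>e\<^sub>1, \<dots>, e\<^sub>7\<close> satisfy \<open>e\<^sub>i\<^sup>2 = -1\<close>, anticommute, and multiply by the oriented lines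
  \<open>e\<^sub>i e\<^sub>j = e\<^sub>k\<close> of the Fano plane with \<open>(i, j, k)\<close> a cyclic permutation of one of
  124, 235, 346, 457, 561, 672, 713.
\<close>

instantiation octonion :: "{one, times}"
begin

primcorec one_octonion :: octonion where
  "oRe 1 = 1"
| "oIm1 1 = 0"
| "oIm2 1 = 0"
| "oIm3 1 = 0"
| "oIm4 1 = 0"
| "oIm5 1 = 0"
| "oIm6 1 = 0"
| "oIm7 1 = 0"

primcorec times_octonion :: "octonion \<Rightarrow> octonion \<Rightarrow> octonion" where
  "oRe (x * y) =
      oRe x * oRe y - oIm1 x * oIm1 y - oIm2 x * oIm2 y - oIm3 x * oIm3 y
      - oIm4 x * oIm4 y - oIm5 x * oIm5 y - oIm6 x * oIm6 y - oIm7 x * oIm7 y"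
| "oIm1 (x * y) =
      oRe x * oIm1 y + oIm1 x * oRe y + oIm2 x * oIm4 y + oIm3 x * oIm7 y
      - oIm4 x * oIm2 y + oIm5 x * oIm6 y - oIm6 x * oIm5 y - oIm7 x * oIm3 y"
| "oIm2 (x * y) =
      oRe x * oIm2 y - oIm1 x * oIm4 y + oIm2 x * oRe y + oIm3 x * oIm5 y
      + oIm4 x * oIm1 y - oIm5 x * oIm3 y + oIm6 x * oIm7 y - oIm7 x * oIm6 y"
| "oIm3 (x * y) =
      oRe x * oIm3 y - oIm1 x * oIm7 y - oIm2 x * oIm5 y + oIm3 x * oRe y
      + oIm4 x * oIm6 y + oIm5 x * oIm2 y - oIm6 x * oIm4 y + oIm7 x * oIm1 y"
| "oIm4 (x * y) =
      oRe x * oIm4 y + oIm1 x * oIm2 y - oIm2 x * oIm1 y - oIm3 x * oIm6 y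
      + oIm4 x * oRe y + oIm5 x * oIm7 y + oIm6 x * oIm3 y - oIm7 x * oIm5 y"
| "oIm5 (x * y) =
      oRe x * oIm5 y - oIm1 x * oIm6 y + oIm2 x * oIm3 y - oIm3 x * oIm2 y
      - oIm4 x * oIm7 y + oIm5 x * oRe y + oIm6 x * oIm1 y + oIm7 x * oIm4 y"
| "oIm6 (x * y) =
      oRe x * oIm6 y + oIm1 x * oIm5 y - oIm2 x * oIm7 y + oIm3 x * oIm4 y
      - oIm4 x * oIm3 y - oIm5 x * oIm1 y + oIm6 x * oRe y + oIm7 x * oIm2 y"
| "oIm7 (x * y) =
      oRe x * oIm7 y + oIm1 x * oIm3 y + oIm2 x * oIm6 y - oIm3 x * oIm1 y
      + oIm4 x * oIm5 y - oIm5 x * oIm4 y - oIm6 x * oIm2 y + oIm7 x * oRe y"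

instance ..

end

text \<open>
  Multiplication is not associative; for the class \<open>power\<close>, \<open>x ^ n\<close> is bracketed to the right,
  which is immaterial because octonions are power-associative.
\<close>

instance octonion :: power ..

instantiation octonion :: real_inner
begin

primcorec scaleR_octonion :: "real \<Rightarrow> octonion \<Rightarrow> octonion" where
  "oRe (r *\<^sub>R x) = r * oRe x"
| "oIm1 (r *\<^sub>R x) = r * oIm1 x"
| "oIm2 (r *\<^sub>R x) = r * oIm2 x"
| "oIm3 (r *\<^sub>R x) = r * oIm3 x"
| "oIm4 (r *\<^sub>R x) = r * oIm4 x"
| "oIm5 (r *\<^sub>R x) = r * oIm5 x"
| "oIm6 (r *\<^sub>R x) = r * oIm6 x"
| "oIm7 (r *\<^sub>R x) = r * oIm7 x"

definition inner_octonion :: "octonion \<Rightarrow> octonion \<Rightarrow> real" where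
  "inner_octonion x y =
     oRe x * oRe y + oIm1 x * oIm1 y + oIm2 x * oIm2 y + oIm3 x * oIm3 y +
     oIm4 x * oIm4 y + oIm5 x * oIm5 y + oIm6 x * oIm6 y + oIm7 x * oIm7 y"

definition norm_octonion :: "octonion \<Rightarrow> real" where
  "norm_octonion x = sqrt (inner x x)"

definition sgn_octonion :: "octonion \<Rightarrow> octonion" where
  "sgn_octonion x = inverse (norm x) *\<^sub>R x"

definition dist_octonion :: "octonion \<Rightarrow> octonion \<Rightarrow> real" where
  "dist_octonion x y = norm (x - y)"

definition uniformity_octonion :: "(octonion \<times> octonion) filter" where
  "uniformity_octonion = (INF e\<in>{0<..}. principal {(x, y). dist x y < e})"

definition open_octonion :: "octonion set \<Rightarrow> bool" where
  "open_octonion U \<longleftrightarrow>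
    (\<forall>x\<in>U. eventually (\<lambda>(x', y). x' = x \<longrightarrow> y \<in> U) uniformity)"

instance
proof
  fix x y z :: octonion and r s :: real and U :: "octonion set"
  show "r *\<^sub>R (x + y) = r *\<^sub>R x + r *\<^sub>R y" "(r + s) *\<^sub>R x = r *\<^sub>R x + s *\<^sub>R x"
    "r *\<^sub>R s *\<^sub>R x = (r * s) *\<^sub>R x" "1 *\<^sub>R x = x"
    by (simp_all add: octonion_eq_iff algebra_simps)
  show "inner x y = inner y x" "inner (x + y) z = inner x z + inner y z"
    "inner (r *\<^sub>R x) y = r * inner x y"
    by (simp_all add: inner_octonion_def algebra_simps)
  show "0 \<le> inner x x"
    by (simp add: inner_octonion_def)
  show "inner x x = 0 \<longleftrightarrow> x = 0"
    by (simp add: inner_octonion_def octonion_eq_iff add_nonneg_eq_0_iff)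
qed (fact norm_octonion_def sgn_octonion_def dist_octonion_def uniformity_octonion_def
      open_octonion_def)+

end

instantiation octonion :: euclidean_space
begin

definition Basis_octonion :: "octonion set" where
  "Basis_octonion =
    {Octonion 1 0 0 0 0 0 0 0,
     Octonion 0 1 0 0 0 0 0 0,
     Octonion 0 0 1 0 0 0 0 0,
     Octonion 0 0 0 1 0 0 0 0,
     Octonion 0 0 0 0 1 0 0 0,
     Octonion 0 0 0 0 0 1 0 0,
     Octonion 0 0 0 0 0 0 1 0,
     Octonion 0 0 0 0 0 0 0 1}"

instance
proof
  fix x u v :: octonion
  show "(Basis :: octonion set) \<noteq> {}" "finite (Basis :: octonion set)"
    by (simp_all add: Basis_octonion_def)
  show "u \<in> Basis \<Longrightarrow> v \<in> Basis \<Longrightarrow> inner u v = (if u = v then 1 else 0)"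
    unfolding Basis_octonion_def
    by (elim insertE emptyE; simp add: inner_octonion_def)
  show "(\<forall>u\<in>Basis. inner x u = 0) \<longleftrightarrow> x = 0"
    unfolding octonion_eq_iff [of x 0] by (simp add: Basis_octonion_def inner_octonion_def)
qed

end

primcorec ocnj :: "octonion \<Rightarrow> octonion" where
  "oRe (ocnj x) = oRe x"
| "oIm1 (ocnj x) = - oIm1 x"
| "oIm2 (ocnj x) = - oIm2 x"
| "oIm3 (ocnj x) = - oIm3 x"
| "oIm4 (ocnj x) = - oIm4 x"
| "oIm5 (ocnj x) = - oIm5 x"
| "oIm6 (ocnj x) = - oIm6 x"
| "oIm7 (ocnj x) = - oIm7 x"

definition octonion_of_real :: "real \<Rightarrow> octonion" where
  "octonion_of_real r = r *\<^sub>R 1"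

instantiation octonion :: inverse
begin

definition inverse_octonion :: "octonion \<Rightarrow> octonion" where
  "inverse_octonion x = (1 / (norm x)\<^sup>2) *\<^sub>R ocnj x"

definition divide_octonion :: "octonion \<Rightarrow> octonion \<Rightarrow> octonion" where
  "divide_octonion x y = x * inverse y"

instance ..

end

lemma octonion_norm_sq: "(norm (x :: octonion))\<^sup>2 = inner x x"
  by (rule power2_norm_eq_inner)

lemma octonion_mult_cnj: "x * ocnj x = octonion_of_real ((norm x)\<^sup>2)"
  unfolding octonion_eq_iff octonion_norm_sq octonion_of_real_def inner_octonion_def
  by (intro conjI; simp)

lemma octonion_right_inverse: "x \<noteq> 0 \<Longrightarrow> x * inverse x = (1 :: octonion)"
proof -
  have "x * r *\<^sub>R y = r *\<^sub>R (x * y)" for r and y :: octonion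
    unfolding octonion_eq_iff by (intro conjI; simp; algebra)
  then show "x \<noteq> 0 \<Longrightarrow> x * inverse x = 1"
    by (simp add: inverse_octonion_def octonion_mult_cnj octonion_of_real_def)
qed

text \<open>
  By Hurwitz's theorem, the next lemma characterises the product among the unital bilinear products
  on an 8-dimensional Euclidean space, up to isomorphism.
\<close>

lemma octonion_norm_mult: "norm (x * y) = norm x * norm (y :: octonion)"
proof -
  have adjoint: "inner (x * y) z = inner y (ocnj x * z)" for z
    unfolding inner_octonion_def by (simp add: algebra_simps)
  have "ocnj x * (x * y) = inner x x *\<^sub>R y"
    unfolding octonion_eq_iff inner_octonion_def by (intro conjI; simp; algebra)
  then have "inner (x * y) (x * y) = inner x x * inner y y"
    by (simp add: adjoint)
  then show ?thesis
    by (metis norm_eq_sqrt_inner real_sqrt_mult)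
qed

definition imaginary_sphere :: "octonion set" where
  "imaginary_sphere = {I. oRe I = 0 \<and> norm I = 1}"

definition slice_point :: "octonion \<Rightarrow> real \<Rightarrow> real \<Rightarrow> octonion" where
  "slice_point I u v = octonion_of_real u + v *\<^sub>R I"

definition slice_plane :: "octonion \<Rightarrow> octonion set" where
  "slice_plane I = {slice_point I u v | u v. True}"

definition slice_monogenic_on :: "octonion set \<Rightarrow> (octonion \<Rightarrow> octonion) \<Rightarrow> bool" where
  "slice_monogenic_on \<Omega> f \<longleftrightarrow>
     f differentiable_on \<Omega> \<and>
     (\<forall>I\<in>imaginary_sphere. \<forall>u v. slice_point I u v \<in> \<Omega> \<longrightarrow>
        (1/2) *\<^sub>R (vector_derivative (\<lambda>s. f (slice_point I s v)) (at u)
               + I * vector_derivative (\<lambda>t. f (slice_point I u t)) (at v)) = 0)"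

text \<open>
  The set \<open>\<Omega> \<inter> slice_plane I\<close> in the coordinates \<open>(u, v)\<close>; integrals over it with
  respect to \<open>du dv\<close> are taken over this region with respect to \<^const>\<open>lborel\<close> on the plane.
\<close>

definition slice_region :: "octonion set \<Rightarrow> octonion \<Rightarrow> (real \<times> real) set" where
  "slice_region \<Omega> I = {(u, v). slice_point I u v \<in> \<Omega>}"

definition slice_bergman :: "octonion set \<Rightarrow> (octonion \<Rightarrow> octonion) set" where
  "slice_bergman \<Omega> =
     {f. slice_monogenic_on \<Omega> f \<and>
         (\<exists>I\<in>imaginary_sphere.
            set_integrable lborel (slice_region \<Omega> I) (\<lambda>(u, v). (norm (f (slice_point I u v)))\<^sup>2))}"

definition slice_inner_integrable ::
    "octonion set \<Rightarrow> octonion \<Rightarrow> (octonion \<Rightarrow> octonion) \<Rightarrow> (octonion \<Rightarrow> octonion) \<Rightarrow> bool" where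
  "slice_inner_integrable \<Omega> I f g \<longleftrightarrow>
     set_integrable lborel (slice_region \<Omega> I)
       (\<lambda>(u, v). ocnj (g (slice_point I u v)) * f (slice_point I u v))"

definition slice_inner ::
    "octonion set \<Rightarrow> octonion \<Rightarrow> (octonion \<Rightarrow> octonion) \<Rightarrow> (octonion \<Rightarrow> octonion) \<Rightarrow> octonion" where
  "slice_inner \<Omega> I f g =
     set_lebesgue_integral lborel (slice_region \<Omega> I)
       (\<lambda>(u, v). ocnj (g (slice_point I u v)) * f (slice_point I u v))"

text \<open>
  Integrability is required explicitly because the Bochner integral of a non-integrable function
  is 0 by convention.
\<close>

definition reproducing_kernel ::
    "octonion set \<Rightarrow> (octonion \<Rightarrow> octonion \<Rightarrow> octonion) \<Rightarrow> bool" where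
  "reproducing_kernel \<Omega> B \<longleftrightarrow>
     (\<forall>f\<in>slice_bergman \<Omega>. \<forall>I\<in>imaginary_sphere. \<forall>x\<in>\<Omega> \<inter> slice_plane I.
        slice_inner_integrable \<Omega> I f (\<lambda>y. B y x) \<and> slice_inner \<Omega> I f (\<lambda>y. B y x) = f x)"

definition half_space :: "octonion set" where
  "half_space = {x. 0 < oRe x}"

definition strip :: "real \<Rightarrow> octonion set" where
  "strip d = {x. 0 < oRe x \<and> oRe x < d}"

definition kernel_half_space :: "octonion \<Rightarrow> octonion \<Rightarrow> octonion" where
  "kernel_half_space x y =
     (1 / pi) *\<^sub>R (inverse ((x\<^sup>2 + (2 * oRe y) *\<^sub>R x + octonion_of_real ((norm y)\<^sup>2))\<^sup>2)
                 * (x\<^sup>2 + 2 *\<^sub>R (x * y) + y\<^sup>2))"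

definition kernel_strip_term :: "real \<Rightarrow> octonion \<Rightarrow> octonion \<Rightarrow> int \<Rightarrow> octonion" where
  "kernel_strip_term d x y n =
     kernel_half_space x (octonion_of_real (2 * d * of_int n) + y)"

definition kernel_strip :: "real \<Rightarrow> octonion \<Rightarrow> octonion \<Rightarrow> octonion" where
  "kernel_strip d x y = (\<Sum>\<^sub>\<infinity>n\<in>UNIV. kernel_strip_term d x y n)"

end

theory Submission
  imports Defs "HOL-Complex_Analysis.Complex_Analysis" "HOL-Probability.Sinc_Integral"
    "HOL-Real_Asymp.Real_Asymp"
begin

text \<open>
  The proof reduces to one complex variable. Left multiplication by \<open>I\<close> squares to \<open>-1\<close> on the octonions,
  hence turns them into a complex vector space on which \<open>\<complex>\<^sub>I\<close> acts associatively
  (\<open>emb_mult_assoc\<close>). A slice monogenic function restricted to \<open>\<complex>\<^sub>I\<close> is a holomorphic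
  function with values in this space, so composing it with the complex linear functionals
  \<open>slice_functional I w\<close>, which separate points, gives ordinary holomorphic functions. For arguments
  in \<open>\<complex>\<^sub>I\<close> the quadratic in the inverted factor splits as \<open>(y + x)(y + cnj x)\<close> and the kernel collapses
  to \<open>1 / (\<pi> (y + cnj x)\<^sup>2)\<close> (\<open>kernel_half_space_emb\<close>). The Bergman condition is imposed on one
  slice only; the representation formula bounds the values on any slice by those on that one, so it
  holds on all of them (\<open>slice_bergman_all_slices\<close>).

  The rest concerns scalar functions. Let \<open>f\<close> be holomorphic and square integrable on a vertical strip or on the
  right half-plane. On the line \<open>Re y = u\<close> one has \<open>cnj y = 2 u - y\<close>, so there the antiholomorphic
  function \<open>1 / (cnj y + q)\<^sup>2\<close> agrees with the holomorphic function \<open>1 / (y - (q + 2 u))\<^sup>2\<close>. By Cauchy's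
  theorem the integral of \<open>f\<close> against it over the line \<open>u\<close> may be moved to a fixed line \<open>c\<close>, as long
  as the pole \<open>q + 2 u\<close> does not lie between them. On the line \<open>c\<close> the integration over \<open>u\<close> is
  elementary and leaves half the difference of two Cauchy integrals of \<open>f\<close> over that line
  (\<open>conjugate_kernel_strip_integral\<close>).

  For the half-plane take \<open>q = x\<close>, \<open>0 < c < Re x\<close> and all \<open>u > 0\<close>. What remains is minus half the
  Cauchy integral of \<open>f\<close> at \<open>x\<close> over a line to the left of \<open>x\<close>. Passing to the right of \<open>x\<close> adds
  \<open>2 \<pi> f x\<close> (\<open>cauchy_line_jump\<close>), and over suitable lines far to the right the Cauchy integral is
  arbitrarily small.

  For the strip of width \<open>d\<close> the summands have \<open>q\<^sub>n = x + 2 d n\<close>. Moving the lines with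
  \<open>u < d/2\<close> to some \<open>c1 < Re x\<close> and those with \<open>u > d/2\<close> to some \<open>c2 > Re x\<close> never crosses a
  pole (\<open>integral_\<Phi>\<close>). The resulting Cauchy integrals telescope in \<open>n\<close>, except that the one at
  \<open>q\<^sub>0 = x\<close> occurs once over \<open>c1\<close> and once over \<open>c2\<close>; half the jump between the two is
  \<open>\<pi> f x\<close> (\<open>pair_integrals_sums\<close>).

  Since \<open>f\<close> is only square integrable, vertical lines are chosen among the almost all ones on which
  \<open>f\<close> is square integrable, and in the contour arguments the horizontal sides are discarded at
  suitable heights supplied by Fubini's theorem (\<open>vertical_line_jump\<close>).
\<close>

section \<open>Lorentzians and products of square integrable functions\<close>

lemma
  fixes \<delta> t :: real
  assumes "\<delta> > 0"
  shows integrable_lorentzian: "integrable lborel (\<lambda>v. 1 / (\<delta>\<^sup>2 + (v - t)\<^sup>2))"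
    and integral_lorentzian: "(LINT v|lborel. 1 / (\<delta>\<^sup>2 + (v - t)\<^sup>2)) = pi / \<delta>"
proof -
  let ?f = "\<lambda>x::real. inverse (1 + x\<^sup>2)"
  have E: "einterval (-\<infinity>) \<infinity> = (UNIV :: real set)"
    by (auto simp: einterval_def)
  have i: "integrable lborel ?f"
    using integrable_inverse_1_plus_square by (simp add: set_integrable_def E)
  have p: "integral\<^sup>L lborel ?f = pi"
    using LBINT_inverse_1_plus_square
    by (simp add: interval_lebesgue_integral_def set_lebesgue_integral_def E)
  have eq: "?f (- (t / \<delta>) + (1 / \<delta>) * v) = \<delta>\<^sup>2 * (1 / (\<delta>\<^sup>2 + (v - t)\<^sup>2))" for v
  proof -
    have "- (t / \<delta>) + (1 / \<delta>) * v = (v - t) / \<delta>"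
      using assms by (simp add: field_simps)
    moreover have "1 + ((v - t) / \<delta>)\<^sup>2 = (\<delta>\<^sup>2 + (v - t)\<^sup>2) / \<delta>\<^sup>2"
      using assms by (simp add: power_divide field_simps)
    ultimately show ?thesis by simp
  qed
  have "integrable lborel (\<lambda>v. \<delta>\<^sup>2 * (1 / (\<delta>\<^sup>2 + (v - t)\<^sup>2)))"
    using lborel_integrable_real_affine [OF i, of "1 / \<delta>" "- (t / \<delta>)"] assms unfolding eq by simp
  from integrable_mult_right [OF this, of "1 / \<delta>\<^sup>2"] assms
  show "integrable lborel (\<lambda>v. 1 / (\<delta>\<^sup>2 + (v - t)\<^sup>2))" by simp
  have "pi = \<bar>1 / \<delta>\<bar> * (LINT v|lborel. \<delta>\<^sup>2 * (1 / (\<delta>\<^sup>2 + (v - t)\<^sup>2)))"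
    using lborel_integral_real_affine [of "1 / \<delta>" ?f "- (t / \<delta>)"] assms unfolding eq p by simp
  also have "\<dots> = \<delta> * (LINT v|lborel. 1 / (\<delta>\<^sup>2 + (v - t)\<^sup>2))"
    using assms by (simp only: integral_mult_right_zero) (simp add: power2_eq_square)
  finally show "(LINT v|lborel. 1 / (\<delta>\<^sup>2 + (v - t)\<^sup>2)) = pi / \<delta>"
    using assms by (metis nonzero_mult_div_cancel_left less_irrefl)
qed

text \<open>
  The weight balances the two squares: choosing \<open>r\<close> by the size of the kernel below turns this into
  quantitative decay without the Cauchy-Schwarz inequality for integrals.
\<close>
lemma norm_mult_le_weighted_squares:
  fixes a b :: complex and r :: real
  assumes "r > 0"
  shows "norm (a * b) \<le> ((norm a)\<^sup>2 / r + r * (norm b)\<^sup>2) / 2"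
proof -
  have "0 \<le> (norm a - r * norm b)\<^sup>2 / r" using assms by simp
  also have "\<dots> = (norm a)\<^sup>2 / r + r * (norm b)\<^sup>2 - 2 * (norm a * norm b)"
    using assms by (simp add: power2_eq_square field_simps)
  finally show ?thesis by (simp add: norm_mult)
qed

lemma integrable_mult_L2:
  fixes f g :: "'a \<Rightarrow> complex"
  assumes [measurable]: "f \<in> borel_measurable M" "g \<in> borel_measurable M"
    and f: "integrable M (\<lambda>x. (norm (f x))\<^sup>2)" and g: "integrable M (\<lambda>x. (norm (g x))\<^sup>2)"
  shows "integrable M (\<lambda>x. f x * g x)"
proof (rule Bochner_Integration.integrable_bound)
  show "integrable M (\<lambda>x. ((norm (f x))\<^sup>2 + (norm (g x))\<^sup>2) / 2)"
    using f g by simp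
  show "AE x in M. norm (f x * g x) \<le> norm (((norm (f x))\<^sup>2 + (norm (g x))\<^sup>2) / 2)"
    using norm_mult_le_weighted_squares [of 1 "f _" "g _"] by (auto intro!: AE_I2 simp: abs_of_nonneg)
qed simp

lemma set_integrable_mult_L2:
  fixes f g :: "'a \<Rightarrow> complex"
  assumes m: "set_borel_measurable M S f" "set_borel_measurable M S g"
    and f: "set_integrable M S (\<lambda>x. (norm (f x))\<^sup>2)" and g: "set_integrable M S (\<lambda>x. (norm (g x))\<^sup>2)"
  shows "set_integrable M S (\<lambda>x. f x * g x)"
proof -
  have eq: "(norm (indicator S x *\<^sub>R h x))\<^sup>2 = indicator S x *\<^sub>R (norm (h x))\<^sup>2" for h :: "'a \<Rightarrow> complex" and x
    by (auto simp: indicator_def)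
  have "integrable M (\<lambda>x. (indicator S x *\<^sub>R f x) * (indicator S x *\<^sub>R g x))"
    using assms by (intro integrable_mult_L2) (simp_all only: eq set_integrable_def set_borel_measurable_def)
  moreover have "(indicator S x *\<^sub>R f x) * (indicator S x *\<^sub>R g x) = indicator S x *\<^sub>R (f x * g x)" for x
    by (auto simp: indicator_def)
  ultimately show ?thesis by (simp only: set_integrable_def)
qed

section \<open>The residue between two vertical lines\<close>

lemma has_contour_integral_linepath_same_Im_iff:
  assumes "Im z = h" "Im z' = h" "Re z = a" "Re z' = b" "a < b"
  shows "(f has_contour_integral I) (linepath z z') \<longleftrightarrow>
         ((\<lambda>x. f (Complex x h)) has_integral I) {a..b}"
proof -
  have lp: "linepath z z' x = linepath (of_real a) (of_real b) x + \<i> * of_real h" for x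
    using assms by (simp add: linepath_def complex_eq_iff algebra_simps)
  have dz: "z' - z = of_real b - of_real a"
    using assms by (simp add: complex_eq_iff)
  have "(f has_contour_integral I) (linepath z z') \<longleftrightarrow>
        ((\<lambda>w. f (w + \<i> * of_real h)) has_contour_integral I) (linepath (of_real a) (of_real b))"
    unfolding has_contour_integral_linepath lp dz ..
  also have "\<dots> \<longleftrightarrow> ((\<lambda>x. f (of_real x + \<i> * of_real h)) has_integral I) {a..b}"
    using assms by (subst has_contour_integral_linepath_Reals_iff) auto
  finally show ?thesis by (simp add: Complex_eq)
qed

lemma tendsto_symmetric_integral:
  fixes g :: "real \<Rightarrow> complex"
  assumes "integrable lborel g"
  shows "((\<lambda>V. LINT v:{t - V..t + V}|lborel. g v) \<longlongrightarrow> integral\<^sup>L lborel g) at_top"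
  unfolding set_lebesgue_integral_def
proof (rule integral_dominated_convergence_at_top [where w = "\<lambda>v. norm (g v)"])
  show "AE v in lborel. ((\<lambda>V. indicator {t - V..t + V} v *\<^sub>R g v) \<longlongrightarrow> g v) at_top"
  proof (rule AE_I2)
    fix v :: real
    have "eventually (\<lambda>V. indicator {t - V..t + V} v *\<^sub>R g v = g v) at_top"
      using eventually_ge_at_top [of "\<bar>v - t\<bar>"] by eventually_elim (auto simp: indicator_def)
    then show "((\<lambda>V. indicator {t - V..t + V} v *\<^sub>R g v) \<longlongrightarrow> g v) at_top"
      by (rule tendsto_eventually)
  qed
  show "\<forall>\<^sub>F V in at_top. AE x in lborel. norm (indicator {t - V..t + V} x *\<^sub>R g x) \<le> norm (g x)"
    by (intro always_eventually allI AE_I2) (auto simp: indicator_def)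
qed (use assms in \<open>auto intro: borel_measurable_integrable\<close>)

text \<open>
  The points beyond \<open>V\<close> at which \<open>h\<close> is small do not form a null set, so a property \<open>P\<close> that holds
  almost everywhere can be imposed on them.
\<close>
lemma integrable_not_bounded_below:
  fixes h :: "real \<Rightarrow> real"
  assumes "integrable lborel h" "\<epsilon> > 0" "AE v in lborel. P v"
  shows "\<exists>v\<ge>V. P v \<and> h v < \<epsilon>"
proof (rule ccontr)
  assume "\<not> ?thesis"
  then have ge: "h v \<ge> \<epsilon>" if "v \<ge> V" "P v" for v using that by force
  have "integrable lborel (\<lambda>v. indicator {V..} v *\<^sub>R \<epsilon>)"
    using assms(1)
  proof (rule Bochner_Integration.integrable_bound)
    show "AE v in lborel. norm (indicator {V..} v *\<^sub>R \<epsilon>) \<le> norm (h v)"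
      using assms(3) by eventually_elim (use ge \<open>\<epsilon> > 0\<close> in \<open>force simp: indicator_def\<close>)
  qed simp
  then have fin: "emeasure lborel {V..} < \<infinity>"
    using \<open>\<epsilon> > 0\<close> by (simp add: integrable_indicator_iff)
  have "ennreal (real n) \<le> emeasure lborel {V..}" for n
    using emeasure_mono [of "{V..V + real n}" "{V..}" lborel] by simp
  with fin show False
    by (metis ennreal_of_nat_eq_real_of_nat infinity_ennreal_def leD ennreal_Ex_less_of_nat)
qed

text \<open>
  Cauchy's integral formula on a rectangle of half-height \<open>V\<close> around \<open>p\<close>, with the two vertical
  sides collected on the left.
\<close>
lemma rectangle_cauchy_formula:
  fixes F :: "complex \<Rightarrow> complex"
  assumes "c1 < Re p" "Re p < c2" "V > 0"
    and F: "F holomorphic_on S" "open S" "{z. c1 \<le> Re z \<and> Re z \<le> c2} \<subseteq> S"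
  defines "G \<equiv> \<lambda>z. F z / (z - p)"
  shows "(LINT v:{Im p - V..Im p + V}|lborel. G (Complex c2 v))
       - (LINT v:{Im p - V..Im p + V}|lborel. G (Complex c1 v))
       - 2 * pi * F p
       = - \<i> * ((LINT u:{c1..c2}|lborel. G (Complex u (Im p + V)))
              - (LINT u:{c1..c2}|lborel. G (Complex u (Im p - V))))"
proof -
  define T where "T = {z. c1 \<le> Re z \<and> Re z \<le> c2}"
  define a1 a2 a3 a4 where "a1 = Complex c1 (Im p - V)" and "a2 = Complex c2 (Im p - V)"
    and "a3 = Complex c2 (Im p + V)" and "a4 = Complex c1 (Im p + V)"
  note a_def = a1_def a2_def a3_def a4_def
  have conT: "convex T"
    unfolding T_def using convex_Int [OF convex_halfspace_Re_ge convex_halfspace_Re_le]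
    by (simp add: Int_def)
  have "open {z. c1 < Re z \<and> Re z < c2}"
    using open_Int [OF open_halfspace_Re_gt open_halfspace_Re_lt] by (simp add: Int_def)
  then have pT: "p \<in> interior T"
    using assms by (intro interiorI [where T = "{z. c1 < Re z \<and> Re z < c2}"]) (auto simp: T_def)
  have pbox: "p \<in> box a1 a3"
    using assms by (auto simp: a_def in_box_complex_iff)
  have im: "path_image (rectpath a1 a3) \<subseteq> T - {p}"
    using assms pbox by (subst path_image_rectpath_cbox_minus_box)
      (auto simp: a_def T_def in_cbox_complex_iff)
  have "((\<lambda>z. F z / (z - p)) has_contour_integral
      2 * pi * \<i> * winding_number (rectpath a1 a3) p * F p) (rectpath a1 a3)"
    using F conT pT im T_def
    by (intro Cauchy_integral_formula_convex_simple [of T]) (auto intro: holomorphic_on_subset)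
  then have main: "(G has_contour_integral 2 * pi * \<i> * F p) (rectpath a1 a3)"
    by (simp add: winding_number_rectpath [OF pbox] G_def)
  have contG: "continuous_on (S - {p}) G"
    unfolding G_def using F
    by (intro continuous_intros) (auto intro: holomorphic_on_imp_continuous_on holomorphic_on_subset)
  have cv: "continuous_on X (\<lambda>v. G (Complex c v))" if "c = c1 \<or> c = c2" for c and X
    using that assms by (intro continuous_on_compose2 [OF contG]) (auto intro!: continuous_intros)
  have ch: "continuous_on {c1..c2} (\<lambda>u. G (Complex u h))" if "h \<noteq> Im p" for h
    using that assms by (intro continuous_on_compose2 [OF contG]) (auto intro!: continuous_intros)
  have 1: "(G has_contour_integral (LINT u:{c1..c2}|lborel. G (Complex u (Im p - V)))) (linepath a1 a2)"
    using assms(1-3) set_borel_integral_eq_integral [OF borel_integrable_atLeastAtMost' [OF ch [of "Im p - V"]]]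
    by (subst has_contour_integral_linepath_same_Im_iff [where h = "Im p - V" and a = c1 and b = c2])
      (simp_all add: a_def has_integral_integral)
  have 3: "(G has_contour_integral (LINT u:{c1..c2}|lborel. G (Complex u (Im p + V)))) (linepath a4 a3)"
    using assms(1-3) set_borel_integral_eq_integral [OF borel_integrable_atLeastAtMost' [OF ch [of "Im p + V"]]]
    by (subst has_contour_integral_linepath_same_Im_iff [where h = "Im p + V" and a = c1 and b = c2])
      (simp_all add: a_def has_integral_integral)
  have 2: "(G has_contour_integral (\<i> * (LINT v:{Im p - V..Im p + V}|lborel. G (Complex c2 v)))) (linepath a2 a3)"
    using \<open>V > 0\<close> set_borel_integral_eq_integral [OF borel_integrable_atLeastAtMost' [OF cv [of c2]]]
    by (subst has_contour_integral_linepath_same_Re_iff [where c = c2 and a = "Im p - V" and b = "Im p + V"])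
      (simp_all add: a_def has_integral_integral)
  have 4: "(G has_contour_integral (\<i> * (LINT v:{Im p - V..Im p + V}|lborel. G (Complex c1 v)))) (linepath a1 a4)"
    using \<open>V > 0\<close> set_borel_integral_eq_integral [OF borel_integrable_atLeastAtMost' [OF cv [of c1]]]
    by (subst has_contour_integral_linepath_same_Re_iff [where c = c1 and a = "Im p - V" and b = "Im p + V"])
      (simp_all add: a_def has_integral_integral)
  have "rectpath a1 a3 = linepath a1 a2 +++ linepath a2 a3 +++ linepath a3 a4 +++ linepath a4 a1"
    by (simp add: rectpath_def Let_def a_def)
  then have "(G has_contour_integral
      (LINT u:{c1..c2}|lborel. G (Complex u (Im p - V))) +
      (\<i> * (LINT v:{Im p - V..Im p + V}|lborel. G (Complex c2 v)) +
      (- (LINT u:{c1..c2}|lborel. G (Complex u (Im p + V))) +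
       - (\<i> * (LINT v:{Im p - V..Im p + V}|lborel. G (Complex c1 v)))))) (rectpath a1 a3)"
    using 1 2 has_contour_integral_reverse_linepath [OF 3] has_contour_integral_reverse_linepath [OF 4]
    by (simp only:) (intro has_contour_integral_join; simp)
  from has_contour_integral_unique [OF this main]
  have "\<i> * ((LINT v:{Im p - V..Im p + V}|lborel. G (Complex c2 v))
       - (LINT v:{Im p - V..Im p + V}|lborel. G (Complex c1 v)) - 2 * pi * F p)
     = (LINT u:{c1..c2}|lborel. G (Complex u (Im p + V))) - (LINT u:{c1..c2}|lborel. G (Complex u (Im p - V)))"
    by (simp add: algebra_simps)
  then have "- \<i> * (\<i> * ((LINT v:{Im p - V..Im p + V}|lborel. G (Complex c2 v))
       - (LINT v:{Im p - V..Im p + V}|lborel. G (Complex c1 v)) - 2 * pi * F p))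
     = - \<i> * ((LINT u:{c1..c2}|lborel. G (Complex u (Im p + V))) - (LINT u:{c1..c2}|lborel. G (Complex u (Im p - V))))"
    by (rule arg_cong)
  then show ?thesis
    by (simp only: mult.assoc [symmetric]) simp
qed

text \<open>
  The limit \<open>V \<rightarrow> \<infinity>\<close> of the rectangle formula. No pointwise decay of \<open>G\<close> is available; integrability
  over the two half-strips is enough, because by Fubini's theorem the integrals over the horizontal
  sides are an integrable function of the height and so become small at suitable heights.
\<close>
lemma vertical_line_jump:
  fixes F :: "complex \<Rightarrow> complex"
  assumes "c1 < Re p" "Re p < c2"
    and F: "F holomorphic_on S" "open S" "{z. c1 \<le> Re z \<and> Re z \<le> c2} \<subseteq> S"
  defines "G \<equiv> \<lambda>z. F z / (z - p)"
  assumes i1: "integrable lborel (\<lambda>v. G (Complex c1 v))"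
    and i2: "integrable lborel (\<lambda>v. G (Complex c2 v))"
    and i: "set_integrable lborel ({c1..c2} \<times> {v. 1 \<le> \<bar>v - Im p\<bar>}) (\<lambda>(u, v). G (Complex u v))"
  shows "(LINT v|lborel. G (Complex c2 v)) - (LINT v|lborel. G (Complex c1 v)) = 2 * pi * F p"
proof (rule ccontr)
  define D where "D = (LINT v|lborel. G (Complex c2 v)) - (LINT v|lborel. G (Complex c1 v)) - 2 * pi * F p"
  assume "\<not> ?thesis"
  then have D: "norm D > 0" by (simp add: D_def)
  define t where "t = Im p"
  define H where "H v = (LINT u:{c1..c2}|lborel. norm (G (Complex u v)))" for v
  define K where "K u v = indicator ({c1..c2} \<times> {v. 1 \<le> \<bar>v - t\<bar>}) (u, v) *\<^sub>R norm (G (Complex u v))" for u v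
  define H' where "H' v = (LINT u|lborel. K u v)" for v
  have "integrable (lborel \<Otimes>\<^sub>M lborel) (case_prod K)"
    using integrable_norm [OF i [unfolded set_integrable_def]]
    by (simp add: K_def lborel_prod t_def case_prod_beta' abs_of_nonneg)
  then have H'i: "integrable lborel H'"
    unfolding H'_def by (rule lborel_pair.integrable_snd)
  have HH': "H' v = H v" if "1 \<le> \<bar>v - t\<bar>" for v
    using that unfolding H_def H'_def K_def set_lebesgue_integral_def
    by (intro Bochner_Integration.integral_cong) (auto simp: indicator_def)
  have "integrable lborel (\<lambda>v. H' (t + v) + H' (t - v))"
    using lborel_integrable_real_affine [OF H'i, of 1 t] lborel_integrable_real_affine [OF H'i, of "-1" t]
    by simp
  note small = integrable_not_bounded_below [OF this, of "norm D / 3" "\<lambda>_. True"]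
  have contG: "continuous_on (S - {p}) G"
    unfolding G_def using F
    by (intro continuous_intros) (auto intro: holomorphic_on_imp_continuous_on holomorphic_on_subset)
  have ch: "continuous_on {c1..c2} (\<lambda>u. G (Complex u h))" if "h \<noteq> Im p" for h
    using that assms by (intro continuous_on_compose2 [OF contG]) (auto intro!: continuous_intros)
  have Hb: "norm (LINT u:{c1..c2}|lborel. G (Complex u h)) \<le> H h" if "h \<noteq> Im p" for h
    unfolding H_def using borel_integrable_atLeastAtMost' [OF ch [OF that]] by (rule set_integral_norm_bound)
  define L1 L2 where "L1 V = (LINT v:{t - V..t + V}|lborel. G (Complex c1 v))"
    and "L2 V = (LINT v:{t - V..t + V}|lborel. G (Complex c2 v))" for V
  have "\<forall>\<^sub>F V in at_top. dist (L1 V) (LINT v|lborel. G (Complex c1 v)) < norm D / 3 \<and>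
     dist (L2 V) (LINT v|lborel. G (Complex c2 v)) < norm D / 3"
    unfolding L1_def L2_def
    using D by (intro eventually_conj tendstoD tendsto_symmetric_integral i1 i2) auto
  then obtain V0 where V0: "dist (L1 V) (LINT v|lborel. G (Complex c1 v)) < norm D / 3"
     "dist (L2 V) (LINT v|lborel. G (Complex c2 v)) < norm D / 3" if "V \<ge> V0" for V
    by (auto simp: eventually_at_top_linorder)
  \<comment> \<open>At a height where both horizontal sides are small, the three errors together stay below \<open>norm D\<close>.\<close>
  obtain V where V: "V \<ge> max 1 V0" and Vs: "H' (t + V) + H' (t - V) < norm D / 3"
    using small [of "max 1 V0"] D by auto
  have "norm (L2 V - L1 V - 2 * pi * F p) \<le> H (t + V) + H (t - V)"
  proof -
    have "L2 V - L1 V - 2 * pi * F p = - \<i> * ((LINT u:{c1..c2}|lborel. G (Complex u (t + V)))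
              - (LINT u:{c1..c2}|lborel. G (Complex u (t - V))))"
      unfolding L1_def L2_def t_def G_def using V assms
      by (intro rectangle_cauchy_formula [where S = S]) auto
    also have "norm \<dots> \<le> norm (LINT u:{c1..c2}|lborel. G (Complex u (t + V)))
        + norm (LINT u:{c1..c2}|lborel. G (Complex u (t - V)))"
      unfolding norm_mult by (simp add: norm_triangle_ineq4)
    also have "\<dots> \<le> H (t + V) + H (t - V)"
      using V by (intro add_mono Hb) (auto simp: t_def)
    finally show ?thesis .
  qed
  then have 1: "norm (L2 V - L1 V - 2 * pi * F p) < norm D / 3"
    using Vs HH' [of "t + V"] HH' [of "t - V"] V by simp
  have "D = (L2 V - L1 V - 2 * pi * F p) + (L1 V - (LINT v|lborel. G (Complex c1 v)))
     - (L2 V - (LINT v|lborel. G (Complex c2 v)))" by (simp add: D_def)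
  also have "norm \<dots> \<le> norm (L2 V - L1 V - 2 * pi * F p) + norm (L1 V - (LINT v|lborel. G (Complex c1 v)))
     + norm (L2 V - (LINT v|lborel. G (Complex c2 v)))"
    by (meson norm_triangle_ineq norm_triangle_ineq4 add_right_mono order_trans)
  also have "\<dots> < norm D / 3 + norm D / 3 + norm D / 3"
    using 1 V0 [of V] V by (simp add: dist_norm)
  finally show False by simp
qed

section \<open>Fubini decomposition into vertical lines\<close>

lemma integrable_prod_fun:
  fixes g h :: "real \<Rightarrow> real"
  assumes g: "integrable lborel g" and h: "integrable lborel h"
  shows "integrable lborel (\<lambda>(u, v). g u * h v)"
  unfolding lborel_prod [symmetric]
proof (rule lborel_pair.Fubini_integrable)
  have [measurable]: "g \<in> borel_measurable borel" "h \<in> borel_measurable borel"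
    using g h by auto
  show "(\<lambda>(u, v). g u * h v) \<in> borel_measurable (lborel \<Otimes>\<^sub>M lborel)" by measurable
  show "integrable lborel (\<lambda>u. LINT v|lborel. norm (case (u, v) of (u, v) \<Rightarrow> g u * h v))"
    using g by (simp add: abs_mult)
  show "AE u in lborel. integrable lborel (\<lambda>v. case (u, v) of (u, v) \<Rightarrow> g u * h v)"
    using h by simp
qed

lemma
  fixes F :: "real \<times> real \<Rightarrow> 'a :: {banach, second_countable_topology}"
  assumes F: "set_integrable lborel (B \<times> UNIV) F"
  shows set_integral_vertical_lines:
      "(LINT p:(B \<times> UNIV)|lborel. F p) = (LINT u:B|lborel. (LINT v|lborel. F (u, v)))"
    and set_integral_horizontal_lines:
      "(LINT p:(B \<times> UNIV)|lborel. F p) = (LINT v|lborel. (LINT u:B|lborel. F (u, v)))"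
    and AE_integrable_vertical_lines:
      "AE u in lborel. u \<in> B \<longrightarrow> integrable lborel (\<lambda>v. F (u, v))"
    and integrable_vertical_lines:
      "set_integrable lborel B (\<lambda>u. LINT v|lborel. F (u, v))"
proof -
  have eq: "indicator (B \<times> UNIV) (u, v) *\<^sub>R F (u, v) = indicator B u *\<^sub>R F (u, v)" for u v
    by (auto simp: indicator_def)
  have F': "integrable (lborel \<Otimes>\<^sub>M lborel) (\<lambda>(u, v). indicator B u *\<^sub>R F (u, v))"
    using F unfolding set_integrable_def lborel_prod [symmetric]
    by (rule back_subst [of "integrable _"]) (auto simp: fun_eq_iff indicator_def)
  have I: "(LINT p:(B \<times> UNIV)|lborel. F p) = integral\<^sup>L (lborel \<Otimes>\<^sub>M lborel) (\<lambda>(u, v). indicator B u *\<^sub>R F (u, v))"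
    unfolding set_lebesgue_integral_def lborel_prod [symmetric]
    by (rule arg_cong [of _ _ "integral\<^sup>L _"]) (auto simp: fun_eq_iff indicator_def)
  show "(LINT p:(B \<times> UNIV)|lborel. F p) = (LINT u:B|lborel. (LINT v|lborel. F (u, v)))"
    unfolding I unfolding lborel_pair.integral_fst [OF F', symmetric] set_lebesgue_integral_def by simp
  show "(LINT p:(B \<times> UNIV)|lborel. F p) = (LINT v|lborel. (LINT u:B|lborel. F (u, v)))"
    unfolding I unfolding lborel_pair.integral_snd [OF F', symmetric] set_lebesgue_integral_def by simp
  show "AE u in lborel. u \<in> B \<longrightarrow> integrable lborel (\<lambda>v. F (u, v))"
    using lborel_pair.AE_integrable_fst [OF F'] by eventually_elim auto
  show "set_integrable lborel B (\<lambda>u. LINT v|lborel. F (u, v))"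
    using lborel_pair.integrable_fst [OF F'] by (simp add: set_integrable_def)
qed

lemma set_borel_measurable_continuous_on:
  fixes k :: "'a::euclidean_space \<Rightarrow> 'b::real_normed_vector"
  assumes "R \<in> sets borel" "continuous_on R k"
  shows "set_borel_measurable lborel R k"
  using borel_measurable_continuous_on_indicator [OF assms]
  by (simp_all add: set_borel_measurable_def)

text \<open>
  All kernels below satisfy such a product bound: a Lorentzian in \<open>v\<close> makes them square integrable on
  vertical lines, the weight \<open>w\<close> makes them square integrable across the strip.
\<close>
lemma set_integrable_lorentzian_bound:
  fixes k :: "real \<times> real \<Rightarrow> 'a :: {banach, second_countable_topology}"
  assumes "R \<in> sets borel" "R \<subseteq> B \<times> UNIV" "continuous_on R k" and w: "set_integrable lborel B w"
    and "\<delta> > 0"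
    and le: "\<And>u v. (u, v) \<in> R \<Longrightarrow> (norm (k (u, v)))\<^sup>2 \<le> w u / (\<delta>\<^sup>2 + (v - t)\<^sup>2)"
  shows "set_integrable lborel R (\<lambda>p. (norm (k p))\<^sup>2)"
  unfolding set_integrable_def
proof (rule Bochner_Integration.integrable_bound)
  show "integrable lborel (\<lambda>(u, v). (indicator B u *\<^sub>R w u) * (1 / (\<delta>\<^sup>2 + (v - t)\<^sup>2)))"
    using w integrable_lorentzian [OF \<open>\<delta> > 0\<close>] by (intro integrable_prod_fun) (simp_all add: set_integrable_def)
  have "continuous_on R (\<lambda>p. (norm (k p))\<^sup>2)"
    using assms by (intro continuous_intros)
  from borel_measurable_continuous_on_indicator [OF assms(1) this]
  show "(\<lambda>p. indicator R p *\<^sub>R (norm (k p))\<^sup>2) \<in> borel_measurable lborel"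
    by simp
  show "AE p in lborel. norm (indicator R p *\<^sub>R (norm (k p))\<^sup>2) \<le>
      norm (case p of (u, v) \<Rightarrow> (indicator B u *\<^sub>R w u) * (1 / (\<delta>\<^sup>2 + (v - t)\<^sup>2)))"
  proof (rule AE_I2, clarify)
    fix u v
    show "norm (indicator R (u, v) *\<^sub>R (norm (k (u, v)))\<^sup>2) \<le>
       norm ((indicator B u *\<^sub>R w u) * (1 / (\<delta>\<^sup>2 + (v - t)\<^sup>2)))"
    proof (cases "(u, v) \<in> R")
      case True
      with assms(2) have "u \<in> B" by auto
      have "(norm (k (u, v)))\<^sup>2 \<le> \<bar>w u / (\<delta>\<^sup>2 + (v - t)\<^sup>2)\<bar>"
        using le [OF True] by linarith
      then show ?thesis
        using True \<open>u \<in> B\<close> by simp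
    qed simp
  qed
qed

lemma norm_sq_inverse_vertical:
  "(norm (1 / (Complex c v - q)))\<^sup>2 = 1 / ((c - Re q)\<^sup>2 + (v - Im q)\<^sup>2)"
  by (simp add: norm_divide power_divide cmod_power2)

lemma inverse_lorentzian_mono:
  fixes \<delta> x y :: real
  assumes "\<delta> > 0" "\<delta> \<le> \<bar>x\<bar>"
  shows "1 / (x\<^sup>2 + y\<^sup>2) \<le> 1 / (\<delta>\<^sup>2 + y\<^sup>2)"
proof -
  have "\<delta>\<^sup>2 \<le> x\<^sup>2"
    using power_mono [OF assms(2), of 2] assms(1) by simp
  moreover have "\<delta>\<^sup>2 + y\<^sup>2 > 0"
    using assms by (simp add: add_pos_nonneg)
  ultimately show ?thesis
    by (intro divide_left_mono) auto
qed

lemma norm_sq_inverse_square_vertical: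
  assumes "\<delta> > 0" "\<delta> \<le> \<bar>Re z\<bar>" "(Im z)\<^sup>2 = y\<^sup>2"
  shows "(norm (1 / z\<^sup>2))\<^sup>2 \<le> (1 / (Re z)\<^sup>2) / (\<delta>\<^sup>2 + y\<^sup>2)"
proof -
  have pos: "(Re z)\<^sup>2 > 0" using assms by auto
  have le: "1 / ((Re z)\<^sup>2 + y\<^sup>2) \<le> 1 / (\<delta>\<^sup>2 + y\<^sup>2)"
    using inverse_lorentzian_mono assms by blast
  have "1 / ((Re z)\<^sup>2 + y\<^sup>2) \<le> 1 / (Re z)\<^sup>2"
    using pos by (intro divide_left_mono mult_pos_pos add_pos_nonneg) auto
  moreover have "(norm (1 / z\<^sup>2))\<^sup>2 = (1 / ((Re z)\<^sup>2 + y\<^sup>2)) * (1 / ((Re z)\<^sup>2 + y\<^sup>2))"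
  proof -
    have "(norm (1 / z\<^sup>2))\<^sup>2 = (1 / (norm z)\<^sup>2) * (1 / (norm z)\<^sup>2)"
      by (simp add: norm_divide norm_power power_divide flip: power_mult power_add)
    then show ?thesis by (simp add: cmod_power2 assms(3))
  qed
  ultimately show ?thesis
    using mult_mono [OF _ le, of "1 / ((Re z)\<^sup>2 + y\<^sup>2)" "1 / (Re z)\<^sup>2"] by simp
qed

lemma norm_sq_inverse_square_le:
  assumes "\<delta> > 0" "\<delta> \<le> \<bar>Re z\<bar>" "(Im z)\<^sup>2 = y\<^sup>2"
  shows "(norm (1 / z\<^sup>2))\<^sup>2 \<le> (1 / \<delta>\<^sup>2) / (\<delta>\<^sup>2 + y\<^sup>2)"
proof -
  have sq: "\<delta>\<^sup>2 \<le> (Re z)\<^sup>2"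
    using power_mono [OF assms(2), of 2] assms(1) by simp
  have "0 < \<delta>\<^sup>2" using assms(1) by simp
  with sq have "1 / (Re z)\<^sup>2 \<le> 1 / \<delta>\<^sup>2" by (intro frac_le) auto
  then have "(1 / (Re z)\<^sup>2) / (\<delta>\<^sup>2 + y\<^sup>2) \<le> (1 / \<delta>\<^sup>2) / (\<delta>\<^sup>2 + y\<^sup>2)"
    by (intro divide_right_mono) auto
  with norm_sq_inverse_square_vertical [OF assms] show ?thesis by (rule order_trans)
qed

section \<open>Square integrable holomorphic functions and their line integrals\<close>

text \<open>
  Taking the set \<open>A\<close> of abscissae as parameter covers the half-plane and the strips at once.
\<close>
locale bergman_function =
  fixes A :: "real set" and f :: "complex \<Rightarrow> complex"
  assumes open_A: "open A" and interval_A: "is_interval A"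
    and holo: "f holomorphic_on {z. Re z \<in> A}"
    and square_integrable: "set_integrable lborel (A \<times> UNIV) (\<lambda>(u, v). (norm (f (Complex u v)))\<^sup>2)"
begin

lemma open_domain: "open {z. Re z \<in> A}"
  using open_vimage [OF open_A, of Re] by (simp add: vimage_def continuous_on_Re)

lemma strip_subset: "\<lbrakk>a \<in> A; b \<in> A\<rbrakk> \<Longrightarrow> {a..b} \<subseteq> A"
  using interval_A unfolding is_interval_1 by fastforce

text \<open>
  The lines over which contours are taken: products of \<open>f\<close> with Cauchy kernels are integrable on them.
\<close>
definition L2_line :: "real \<Rightarrow> bool" where
  "L2_line c \<longleftrightarrow> c \<in> A \<and> integrable lborel (\<lambda>v. (norm (f (Complex c v)))\<^sup>2)"

lemma AE_L2_line: "AE u in lborel. u \<in> A \<longrightarrow> L2_line u"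
  using AE_integrable_vertical_lines [OF square_integrable] by (simp add: L2_line_def)

lemma ex_L2_line:
  assumes "a < b" "{a<..<b} \<subseteq> A"
  obtains c where "a < c" "c < b" "L2_line c"
proof -
  have "\<exists>c. a < c \<and> c < b \<and> L2_line c"
  proof (rule ccontr)
    assume none: "\<not> ?thesis"
    have "AE u in lborel. u \<notin> {a<..<b}"
      using AE_L2_line by eventually_elim (use none assms in auto)
    then have "emeasure lborel {a<..<b} = 0"
      by (subst (asm) AE_iff_measurable [of "{a<..<b}"]) auto
    with \<open>a < b\<close> show False by simp
  qed
  with that show ?thesis by blast
qed

lemma continuous_on_f_vertical: "c \<in> A \<Longrightarrow> continuous_on X (\<lambda>v. f (Complex c v))"
  by (intro continuous_on_compose2 [OF holomorphic_on_imp_continuous_on [OF holo]])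
    (auto intro!: continuous_intros)

lemma continuous_on_f_plane:
  "R \<subseteq> A \<times> UNIV \<Longrightarrow> continuous_on R (\<lambda>(u, v). f (Complex u v))"
  unfolding case_prod_beta'
  by (intro continuous_on_compose2 [OF holomorphic_on_imp_continuous_on [OF holo]])
    (auto intro!: continuous_intros)

lemma borel_measurable_f_vertical:
  "c \<in> A \<Longrightarrow> (\<lambda>v. f (Complex c v)) \<in> borel_measurable borel"
  by (intro borel_measurable_continuous_onI continuous_on_f_vertical)

lemma integrable_vertical_times:
  assumes c: "L2_line c" and k: "continuous_on UNIV k" and "\<delta> > 0"
    and le: "\<And>v. (norm (k v))\<^sup>2 \<le> C / (\<delta>\<^sup>2 + (v - t)\<^sup>2)"
  shows "integrable lborel (\<lambda>v. f (Complex c v) * k v)"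
proof (rule integrable_mult_L2)
  have [measurable]: "k \<in> borel_measurable borel"
    using k by (rule borel_measurable_continuous_onI)
  then show "k \<in> borel_measurable lborel" by simp
  show "(\<lambda>v. f (Complex c v)) \<in> borel_measurable lborel"
    using c by (simp add: L2_line_def borel_measurable_f_vertical)
  show "integrable lborel (\<lambda>v. (norm (f (Complex c v)))\<^sup>2)"
    using c by (simp add: L2_line_def)
  have "integrable lborel (\<lambda>v. C * (1 / (\<delta>\<^sup>2 + (v - t)\<^sup>2)))"
    by (intro integrable_mult_right integrable_lorentzian assms)
  then show "integrable lborel (\<lambda>v. (norm (k v))\<^sup>2)"
  proof (rule Bochner_Integration.integrable_bound)
    show "AE v in lborel. norm ((norm (k v))\<^sup>2) \<le> norm (C * (1 / (\<delta>\<^sup>2 + (v - t)\<^sup>2)))"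
    proof (rule AE_I2)
      fix v
      have "(norm (k v))\<^sup>2 \<le> C * (1 / (\<delta>\<^sup>2 + (v - t)\<^sup>2))"
        using le [of v] by simp
      then show "norm ((norm (k v))\<^sup>2) \<le> norm (C * (1 / (\<delta>\<^sup>2 + (v - t)\<^sup>2)))"
        unfolding real_norm_def using zero_le_power2 [of "norm (k v)"] by linarith
    qed
  qed simp
qed

lemma set_integrable_times:
  assumes R: "R \<in> sets borel" "R \<subseteq> B \<times> UNIV" "B \<subseteq> A" "continuous_on R k"
    and w: "set_integrable lborel B w" "\<delta> > 0"
    and le: "\<And>u v. (u, v) \<in> R \<Longrightarrow> (norm (k (u, v)))\<^sup>2 \<le> w u / (\<delta>\<^sup>2 + (v - t)\<^sup>2)"
  shows "set_integrable lborel R (\<lambda>(u, v). f (Complex u v) * k (u, v))"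
proof -
  have RA: "R \<subseteq> A \<times> UNIV" using R by auto
  have "set_integrable lborel R (\<lambda>p. (case p of (u, v) \<Rightarrow> f (Complex u v)) * k p)"
  proof (rule set_integrable_mult_L2)
    show "set_borel_measurable lborel R (\<lambda>(u, v). f (Complex u v))"
      using R(1) RA by (intro set_borel_measurable_continuous_on continuous_on_f_plane)
    show "set_borel_measurable lborel R k"
      using R by (intro set_borel_measurable_continuous_on)
    show "set_integrable lborel R (\<lambda>p. (norm (case p of (u, v) \<Rightarrow> f (Complex u v)))\<^sup>2)"
      using set_integrable_subset [OF square_integrable, of R] R RA by (simp add: case_prod_beta')
    show "set_integrable lborel R (\<lambda>p. (norm (k p))\<^sup>2)"
      using assms by (intro set_integrable_lorentzian_bound [of R B k w \<delta> t])
  qed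
  then show ?thesis by (simp add: case_prod_beta')
qed

text \<open>
  Cauchy's theorem as the case of the jump formula in which the value at the pole vanishes: any \<open>p\<close>
  between the lines can serve as a pole once the integrand is multiplied by \<open>z - p\<close>.
\<close>
lemma vertical_shift_less:
  assumes a: "L2_line a" and c: "L2_line c" and "a < c"
    and T: "k holomorphic_on T" "open T" "{z. a \<le> Re z \<and> Re z \<le> c} \<subseteq> T"
    and "\<delta> > 0"
    and le: "\<And>u v. \<lbrakk>a \<le> u; u \<le> c\<rbrakk> \<Longrightarrow> (norm (k (Complex u v)))\<^sup>2 \<le> C / (\<delta>\<^sup>2 + (v - t)\<^sup>2)"
  shows "(LINT v|lborel. f (Complex a v) * k (Complex a v)) = (LINT v|lborel. f (Complex c v) * k (Complex c v))"
proof -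
  define p where "p = Complex ((a + c) / 2) 0"
  define F where "F z = (z - p) * (f z * k z)" for z
  have FG: "F z / (z - p) = f z * k z" if "z \<noteq> p" for z
    using that by (simp add: F_def)
  have p: "a < Re p" "Re p < c" using \<open>a < c\<close> by (auto simp: p_def)
  have sub: "{a..c} \<subseteq> A" using a c by (intro strip_subset) (auto simp: L2_line_def)
  have kv: "continuous_on UNIV (\<lambda>v. k (Complex u v))" if "a \<le> u" "u \<le> c" for u
    by (intro continuous_on_compose2 [OF holomorphic_on_imp_continuous_on [OF T(1)]])
      (use that T(3) in \<open>auto intro!: continuous_intros\<close>)
  have iv: "integrable lborel (\<lambda>v. f (Complex u v) * k (Complex u v))" if "a \<le> u" "u \<le> c" "L2_line u" for u
    using that le [of u] \<open>\<delta> > 0\<close> by (intro integrable_vertical_times [of u _ \<delta> C t] kv) auto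
  let ?S = "{z. Re z \<in> A} \<inter> T"
  have line: "F (Complex u v) / (Complex u v - p) = f (Complex u v) * k (Complex u v)"
    if "u = a \<or> u = c" for u v
    using that \<open>a < c\<close> by (intro FG) (auto simp: p_def)
  have "(LINT v|lborel. F (Complex c v) / (Complex c v - p)) - (LINT v|lborel. F (Complex a v) / (Complex a v - p))
      = 2 * pi * F p"
  proof (rule vertical_line_jump [where S = ?S])
    show "F holomorphic_on ?S"
      unfolding F_def using holo T(1)
      by (intro holomorphic_intros) (auto intro: holomorphic_on_subset)
    show "open ?S" using open_domain T(2) by auto
    show "{z. a \<le> Re z \<and> Re z \<le> c} \<subseteq> ?S" using T(3) sub by auto
    show "integrable lborel (\<lambda>v. F (Complex a v) / (Complex a v - p))"
      "integrable lborel (\<lambda>v. F (Complex c v) / (Complex c v - p))"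
      using iv [of a] iv [of c] a c \<open>a < c\<close> by (simp_all add: line)
    have "set_integrable lborel ({a..c} \<times> UNIV) (\<lambda>(u, v). f (Complex u v) * (\<lambda>(u, v). k (Complex u v)) (u, v))"
    proof (rule set_integrable_times [where B = "{a..c}" and w = "\<lambda>_. C" and \<delta> = \<delta> and t = t])
      have "continuous_on ({a..c} \<times> UNIV) (\<lambda>p. k (Complex (fst p) (snd p)))"
        by (intro continuous_on_compose2 [OF holomorphic_on_imp_continuous_on [OF T(1)]])
          (use T(3) in \<open>auto intro!: continuous_intros\<close>)
      then show "continuous_on ({a..c} \<times> UNIV) (\<lambda>(u, v). k (Complex u v))"
        by (simp add: case_prod_beta')
      show "set_integrable lborel {a..c} (\<lambda>_. C)"
        by (intro borel_integrable_atLeastAtMost') auto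
      show "{a..c} \<times> UNIV \<in> sets (borel :: (real \<times> real) measure)"
        by (intro borel_closed closed_Times) auto
    qed (use sub le \<open>\<delta> > 0\<close> in auto)
    then have "set_integrable lborel ({a..c} \<times> UNIV) (\<lambda>(u, v). f (Complex u v) * k (Complex u v))"
      by simp
    then have "set_integrable lborel ({a..c} \<times> {v. 1 \<le> \<bar>v - Im p\<bar>}) (\<lambda>(u, v). f (Complex u v) * k (Complex u v))"
    proof (rule set_integrable_subset)
      have "closed {v. 1 \<le> \<bar>v - Im p\<bar>}" by (intro closed_Collect_le continuous_intros)
      then have "{a..c} \<times> {v. 1 \<le> \<bar>v - Im p\<bar>} \<in> sets borel"
        by (intro borel_closed closed_Times) auto
      then show "{a..c} \<times> {v. 1 \<le> \<bar>v - Im p\<bar>} \<in> sets lborel"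
        by simp
    qed auto
    then show "set_integrable lborel ({a..c} \<times> {v. 1 \<le> \<bar>v - Im p\<bar>}) (\<lambda>(u, v). F (Complex u v) / (Complex u v - p))"
      by (rule set_integrable_cong [THEN iffD1, rotated -1]) (auto intro!: FG [symmetric])
  qed (use p in auto)
  moreover have "F p = 0" by (simp add: F_def)
  ultimately show ?thesis by (simp add: line)
qed

lemma vertical_shift:
  assumes a: "L2_line a" and c: "L2_line c"
    and T: "k holomorphic_on T" "open T" "{z. min a c \<le> Re z \<and> Re z \<le> max a c} \<subseteq> T"
    and "\<delta> > 0"
    and le: "\<And>u v. \<lbrakk>min a c \<le> u; u \<le> max a c\<rbrakk> \<Longrightarrow> (norm (k (Complex u v)))\<^sup>2 \<le> C / (\<delta>\<^sup>2 + (v - t)\<^sup>2)"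
  shows "(LINT v|lborel. f (Complex a v) * k (Complex a v)) = (LINT v|lborel. f (Complex c v) * k (Complex c v))"
proof (cases a c rule: linorder_cases)
  case less
  then show ?thesis using assms by (intro vertical_shift_less [of a c k T \<delta> C t]) auto
next
  case greater
  then show ?thesis using assms by (intro vertical_shift_less [of c a k T \<delta> C t, symmetric]) auto
qed simp

definition cauchy_line :: "real \<Rightarrow> complex \<Rightarrow> complex" where
  "cauchy_line c q = (LINT v|lborel. f (Complex c v) * (1 / (Complex c v - q)))"

lemma integrable_cauchy_line:
  assumes "L2_line c" "Re q \<noteq> c"
  shows "integrable lborel (\<lambda>v. f (Complex c v) * (1 / (Complex c v - q)))"
proof (rule integrable_vertical_times [where \<delta> = "\<bar>c - Re q\<bar>" and t = "Im q" and C = 1])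
  show "continuous_on UNIV (\<lambda>v. 1 / (Complex c v - q))"
    using assms by (auto intro!: continuous_intros)
  show "(norm (1 / (Complex c v - q)))\<^sup>2 \<le> 1 / (\<bar>c - Re q\<bar>\<^sup>2 + (v - Im q)\<^sup>2)" for v
    by (simp add: norm_sq_inverse_vertical)
qed (use assms in auto)

lemma cauchy_line_shift:
  assumes "L2_line a" "L2_line c" "Re q < min a c \<or> max a c < Re q"
  shows "cauchy_line a q = cauchy_line c q"
  unfolding cauchy_line_def
proof (rule vertical_shift [where T = "- {q}" and t = "Im q" and C = 1 and k = "\<lambda>z. 1 / (z - q)"
      and \<delta> = "min \<bar>a - Re q\<bar> \<bar>c - Re q\<bar>"])
  show "(\<lambda>z. 1 / (z - q)) holomorphic_on - {q}" by (intro holomorphic_intros) auto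
  fix u v assume "min a c \<le> u" "u \<le> max a c"
  then have "min \<bar>a - Re q\<bar> \<bar>c - Re q\<bar> \<le> \<bar>u - Re q\<bar>" "min \<bar>a - Re q\<bar> \<bar>c - Re q\<bar> > 0"
    using assms(3) by auto
  then show "(norm (1 / (Complex u v - q)))\<^sup>2 \<le> 1 / ((min \<bar>a - Re q\<bar> \<bar>c - Re q\<bar>)\<^sup>2 + (v - Im q)\<^sup>2)"
    unfolding norm_sq_inverse_vertical by (intro inverse_lorentzian_mono)
qed (use assms in auto)

text \<open>
  The residue of the Cauchy kernel at \<open>p\<close> is what produces the value \<open>f p\<close> in both reproducing formulas.
\<close>
lemma cauchy_line_jump:
  assumes "L2_line c1" "L2_line c2" "c1 < Re p" "Re p < c2"
  shows "cauchy_line c2 p = cauchy_line c1 p + 2 * pi * f p"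
proof -
  have sub: "{c1..c2} \<subseteq> A" using assms by (intro strip_subset) (auto simp: L2_line_def)
  let ?R = "{c1..c2} \<times> {v. 1 \<le> \<bar>v - Im p\<bar>}"
  have "(LINT v|lborel. f (Complex c2 v) / (Complex c2 v - p)) - (LINT v|lborel. f (Complex c1 v) / (Complex c1 v - p))
      = 2 * pi * f p"
  proof (rule vertical_line_jump [OF _ _ holo open_domain])
    show "integrable lborel (\<lambda>v. f (Complex c1 v) / (Complex c1 v - p))"
         "integrable lborel (\<lambda>v. f (Complex c2 v) / (Complex c2 v - p))"
      using integrable_cauchy_line [of c1 p] integrable_cauchy_line [of c2 p] assms by simp_all
    have "set_integrable lborel ?R (\<lambda>(u, v). f (Complex u v) * (\<lambda>(u, v). 1 / (Complex u v - p)) (u, v))"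
    proof (rule set_integrable_times [where B = "{c1..c2}" and w = "\<lambda>_. 2" and \<delta> = 1 and t = "Im p"])
      have "closed {v. 1 \<le> \<bar>v - Im p\<bar>}" by (intro closed_Collect_le continuous_intros)
      then show "?R \<in> sets borel"
        by (intro borel_closed closed_Times) auto
      have "continuous_on ?R (\<lambda>z. 1 / (Complex (fst z) (snd z) - p))"
        by (intro continuous_intros) (auto simp: complex_eq_iff)
      then show "continuous_on ?R (\<lambda>(u, v). 1 / (Complex u v - p))"
        by (simp add: case_prod_beta')
      show "set_integrable lborel {c1..c2} (\<lambda>_. 2::real)"
        by (intro borel_integrable_atLeastAtMost') auto
      \<comment> \<open>At vertical distance at least 1 from the pole the kernel is within a factor 2 of the Lorentzian of width 1.\<close>
      have arith: "1 / (y + x) \<le> 2 / (1 + x)" if "1 \<le> x" "0 \<le> y" for x y :: real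
        using that by (simp add: field_simps)
      fix u v assume "(u, v) \<in> ?R"
      then have "\<bar>v - Im p\<bar> \<ge> 1" by auto
      then have "(v - Im p)\<^sup>2 \<ge> 1"
        using power_mono [of 1 "\<bar>v - Im p\<bar>" 2] by simp
      then show "(norm (case (u, v) of (u, v) \<Rightarrow> 1 / (Complex u v - p)))\<^sup>2 \<le> 2 / (1\<^sup>2 + (v - Im p)\<^sup>2)"
        unfolding prod.case norm_sq_inverse_vertical one_power2 by (rule arith [OF _ zero_le_power2])
    qed (use sub in auto)
    then show "set_integrable lborel ?R (\<lambda>(u, v). f (Complex u v) / (Complex u v - p))"
      by simp
  qed (use assms sub in auto)
  then show ?thesis
    unfolding cauchy_line_def by (simp add: algebra_simps)
qed

section \<open>The antiholomorphic kernel on a strip\<close>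

lemma set_integrable_conjugate_kernel:
  assumes "B \<in> sets borel" "B \<subseteq> A" "\<delta> > 0" "\<And>u. u \<in> B \<Longrightarrow> \<delta> \<le> \<bar>u + Re q\<bar>"
    and "set_integrable lborel B (\<lambda>u. 1 / (u + Re q)\<^sup>2)"
  shows "set_integrable lborel (B \<times> UNIV) (\<lambda>(u, v). f (Complex u v) * (1 / (cnj (Complex u v) + q)\<^sup>2))"
proof -
  let ?k = "\<lambda>(u, v). 1 / (cnj (Complex u v) + q)\<^sup>2"
  have "set_integrable lborel (B \<times> UNIV) (\<lambda>(u, v). f (Complex u v) * ?k (u, v))"
  proof (rule set_integrable_times [where \<delta> = \<delta> and t = "Im q" and B = B])
    show "B \<times> UNIV \<in> sets (borel :: (real \<times> real) measure)"
      using assms by (intro borel_Times) auto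
    have "cnj (Complex u v) + q \<noteq> 0" if "u \<in> B" for u v
      using assms(3) assms(4) [OF that] by (auto simp: complex_eq_iff)
    then have "continuous_on (B \<times> UNIV) (\<lambda>p. 1 / (cnj (Complex (fst p) (snd p)) + q)\<^sup>2)"
      by (intro continuous_intros) auto
    then show "continuous_on (B \<times> UNIV) ?k" by (simp add: case_prod_beta')
    fix u v assume "(u, v) \<in> B \<times> (UNIV :: real set)"
    then show "(norm (?k (u, v)))\<^sup>2 \<le> (1 / (u + Re q)\<^sup>2) / (\<delta>\<^sup>2 + (v - Im q)\<^sup>2)"
      using norm_sq_inverse_square_vertical [of \<delta> "cnj (Complex u v) + q" "v - Im q"] assms(3) assms(4) [of u]
      by (auto simp: power2_commute)
  qed (use assms in auto)
  then show ?thesis by simp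
qed

text \<open>
  The central computation. On the line \<open>Re y = u\<close> the kernel equals \<open>1 / (y - (q + 2 u))\<^sup>2\<close>, and the
  side condition says that its pole lies, with margin \<open>\<delta>\<close>, on the same side of the lines \<open>u\<close> and
  \<open>c\<close>. So \<open>f\<close> can be integrated over the line \<open>c\<close> instead; after exchanging the integrals,
  \<open>1 / (y - (q + 2 u))\<^sup>2\<close> has the primitive \<open>1 / (2 (y - (q + 2 u)))\<close> in \<open>u\<close>.
\<close>
lemma conjugate_kernel_strip_integral:
  assumes "\<alpha> \<le> \<beta>" "{\<alpha><..<\<beta>} \<subseteq> A" and c: "L2_line c" and \<delta>: "\<delta> > 0"
    and side: "\<And>u. u \<in> {\<alpha>..\<beta>} \<Longrightarrow>
      (\<delta> \<le> Re q + u \<and> \<delta> \<le> Re q + 2 * u - c) \<or> (Re q + u \<le> - \<delta> \<and> Re q + 2 * u - c \<le> - \<delta>)"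
  shows "set_integrable lborel ({\<alpha><..<\<beta>} \<times> UNIV) (\<lambda>(u, v). f (Complex u v) * (1 / (cnj (Complex u v) + q)\<^sup>2))"
    and "(LINT p:({\<alpha><..<\<beta>} \<times> UNIV)|lborel. (\<lambda>(u, v). f (Complex u v) * (1 / (cnj (Complex u v) + q)\<^sup>2)) p)
      = (cauchy_line c (q + 2 * of_real \<beta>) - cauchy_line c (q + 2 * of_real \<alpha>)) / 2"
proof -
  let ?B = "{\<alpha><..<\<beta>}"
  let ?\<Phi> = "\<lambda>(u, v). f (Complex u v) * (1 / (cnj (Complex u v) + q)\<^sup>2)"
  let ?\<Psi> = "\<lambda>(u, v). f (Complex c v) * (1 / (Complex c v - (q + 2 * of_real u))\<^sup>2)"
  have cA: "c \<in> A" using c by (simp add: L2_line_def)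
  show i\<Phi>: "set_integrable lborel (?B \<times> UNIV) ?\<Phi>"
  proof (rule set_integrable_conjugate_kernel)
    have "set_integrable lborel {\<alpha>..\<beta>} (\<lambda>u. 1 / (u + Re q)\<^sup>2)"
      using side \<delta> by (intro borel_integrable_atLeastAtMost' continuous_intros) force
    then show "set_integrable lborel ?B (\<lambda>u. 1 / (u + Re q)\<^sup>2)"
      by (rule set_integrable_subset) auto
    show "\<delta> \<le> \<bar>u + Re q\<bar>" if "u \<in> ?B" for u
      using side [of u] that by auto
  qed (use assms in auto)
  have i\<Psi>: "set_integrable lborel (?B \<times> UNIV) ?\<Psi>"
  proof -
    let ?k = "\<lambda>(u, v). 1 / (Complex c v - (q + 2 * of_real u))\<^sup>2"
    have sets: "?B \<times> UNIV \<in> sets (borel :: (real \<times> real) measure)"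
      by (intro borel_Times) auto
    have far: "\<delta> \<le> \<bar>Re (Complex c v - (q + 2 * of_real u))\<bar>" if "u \<in> ?B" for u v
      using side [of u] that by auto
    then have "Complex c v - (q + 2 * of_real u) \<noteq> 0" if "u \<in> ?B" for u v
      using \<delta> that by (metis abs_zero not_less zero_complex.sel(1))
    then have "continuous_on (?B \<times> UNIV) (\<lambda>p. 1 / (Complex c (snd p) - (q + 2 * of_real (fst p)))\<^sup>2)"
      by (intro continuous_intros) auto
    then have ck: "continuous_on (?B \<times> UNIV) ?k" by (simp add: case_prod_beta')
    have cf: "continuous_on (?B \<times> UNIV) (\<lambda>p :: real \<times> real. f (Complex c (snd p)))"
      by (intro continuous_on_compose2 [OF continuous_on_f_vertical [OF cA, of UNIV]] continuous_intros subset_UNIV)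
    have "set_integrable lborel (?B \<times> UNIV) (\<lambda>p. f (Complex c (snd p)) * ?k p)"
    proof (rule set_integrable_mult_L2)
      have "integrable lborel (\<lambda>(u, v). indicator ?B u * (norm (f (Complex c v)))\<^sup>2)"
        using c by (intro integrable_prod_fun integrable_real_indicator) (use \<open>\<alpha> \<le> \<beta>\<close> in \<open>auto simp: L2_line_def\<close>)
      then show "set_integrable lborel (?B \<times> UNIV) (\<lambda>p. (norm (f (Complex c (snd p))))\<^sup>2)"
        unfolding set_integrable_def
        by (rule back_subst [of "integrable _"]) (auto simp: fun_eq_iff indicator_def)
      show "set_integrable lborel (?B \<times> UNIV) (\<lambda>p. (norm (?k p))\<^sup>2)"
      proof (rule set_integrable_lorentzian_bound [where B = ?B and w = "\<lambda>u. 1 / \<delta>\<^sup>2" and \<delta> = \<delta> and t = "Im q"])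
        have "set_integrable lborel {\<alpha>..\<beta>} (\<lambda>u. 1 / \<delta>\<^sup>2)"
          by (intro borel_integrable_atLeastAtMost') auto
        then show "set_integrable lborel ?B (\<lambda>u. 1 / \<delta>\<^sup>2)"
          by (rule set_integrable_subset) auto
        fix u v assume uv: "(u, v) \<in> ?B \<times> (UNIV :: real set)"
        then have u: "u \<in> ?B" by auto
        let ?z = "Complex c v - (q + 2 * of_real u)"
        have "(norm (1 / ?z\<^sup>2))\<^sup>2 \<le> (1 / \<delta>\<^sup>2) / (\<delta>\<^sup>2 + (v - Im q)\<^sup>2)"
          using far [OF u, of v] \<delta> by (intro norm_sq_inverse_square_le) auto
        then show "(norm (?k (u, v)))\<^sup>2 \<le> (1 / \<delta>\<^sup>2) / (\<delta>\<^sup>2 + (v - Im q)\<^sup>2)" by simp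
      qed (use sets ck \<delta> in auto)
    qed (use sets ck cf in \<open>auto intro!: set_borel_measurable_continuous_on\<close>)
    then show ?thesis by (simp add: case_prod_beta')
  qed
  have eq: "(LINT v|lborel. ?\<Phi> (u, v)) = (LINT v|lborel. ?\<Psi> (u, v))" if u: "u \<in> ?B" "L2_line u" for u
  proof -
    let ?q = "q + 2 * of_real u"
    have cnj: "(cnj (Complex u v) + q)\<^sup>2 = (Complex u v - ?q)\<^sup>2" for v
    proof -
      have "cnj (Complex u v) + q = - (Complex u v - ?q)"
        by (simp add: complex_eq_iff)
      then show ?thesis by (metis power2_minus)
    qed
    have far: "\<delta> \<le> \<bar>x - Re ?q\<bar>" if "min u c \<le> x" "x \<le> max u c" for x
      using that side [of u] u(1) by auto
    have "(LINT v|lborel. f (Complex u v) * (1 / (Complex u v - ?q)\<^sup>2))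
        = (LINT v|lborel. f (Complex c v) * (1 / (Complex c v - ?q)\<^sup>2))"
    proof (rule vertical_shift [where T = "- {?q}" and k = "\<lambda>z. 1 / (z - ?q)\<^sup>2" and \<delta> = \<delta> and t = "Im q" and C = "1 / \<delta>\<^sup>2"])
      show "(\<lambda>z. 1 / (z - ?q)\<^sup>2) holomorphic_on - {?q}"
        by (intro holomorphic_intros) auto
      show "{z. min u c \<le> Re z \<and> Re z \<le> max u c} \<subseteq> - {?q}"
        using far [of "Re ?q"] \<delta> by auto
      fix x v assume x: "min u c \<le> x" "x \<le> max u c"
      show "(norm (1 / (Complex x v - ?q)\<^sup>2))\<^sup>2 \<le> (1 / \<delta>\<^sup>2) / (\<delta>\<^sup>2 + (v - Im q)\<^sup>2)"
        using far [OF x] \<delta> by (intro norm_sq_inverse_square_le) auto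
    qed (use u c \<delta> in auto)
    then show ?thesis by (simp only: prod.case cnj)
  qed
  have "(LINT p:(?B \<times> UNIV)|lborel. ?\<Phi> p) = (LINT u:?B|lborel. (LINT v|lborel. ?\<Phi> (u, v)))"
    by (rule set_integral_vertical_lines [OF i\<Phi>])
  also have "\<dots> = (LINT u:?B|lborel. (LINT v|lborel. ?\<Psi> (u, v)))"
    unfolding set_lebesgue_integral_def
  proof (rule integral_cong_AE)
    show "AE u in lborel. indicator ?B u *\<^sub>R (LINT v|lborel. ?\<Phi> (u, v)) = indicator ?B u *\<^sub>R (LINT v|lborel. ?\<Psi> (u, v))"
      using AE_L2_line by eventually_elim (use eq assms(2) in \<open>auto simp: indicator_def\<close>)
  qed (use integrable_vertical_lines [OF i\<Phi>] integrable_vertical_lines [OF i\<Psi>] in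
        \<open>auto simp: set_integrable_def\<close>)
  also have "\<dots> = (LINT p:(?B \<times> UNIV)|lborel. ?\<Psi> p)"
    by (rule set_integral_vertical_lines [OF i\<Psi>, symmetric])
  also have "\<dots> = (LINT v|lborel. (LINT u:?B|lborel. ?\<Psi> (u, v)))"
    by (rule set_integral_horizontal_lines [OF i\<Psi>])
  also have "\<dots> = (LINT v|lborel. (f (Complex c v) * (1 / (Complex c v - (q + 2 * of_real \<beta>)))
      - f (Complex c v) * (1 / (Complex c v - (q + 2 * of_real \<alpha>)))) / 2)"
  proof (rule Bochner_Integration.integral_cong [OF refl])
    fix v
    let ?g = "\<lambda>u. 1 / (Complex c v - (q + 2 * of_real u))\<^sup>2"
    let ?G = "\<lambda>u. (1 / (Complex c v - (q + 2 * of_real u))) / 2"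
    have ne: "Complex c v - (q + 2 * of_real u) \<noteq> 0" if "u \<in> {\<alpha>..\<beta>}" for u
      using side [OF that] \<delta> by (auto simp: complex_eq_iff)
    have cg: "continuous_on {\<alpha>..\<beta>} ?g" using ne by (intro continuous_intros) auto
    have ig: "set_integrable lborel {\<alpha>..\<beta>} ?g" by (rule borel_integrable_atLeastAtMost' [OF cg])
    have "(?g has_integral ?G \<beta> - ?G \<alpha>) {\<alpha>..\<beta>}"
    proof (rule fundamental_theorem_of_calculus [OF \<open>\<alpha> \<le> \<beta>\<close>])
      fix u assume u: "u \<in> {\<alpha>..\<beta>}"
      have "((\<lambda>z. 1 / (Complex c v - (q + 2 * z))) has_field_derivative 2 * ?g u) (at (of_real u))"
        by (rule derivative_eq_intros refl ne [OF u])+ (simp add: power2_eq_square)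
      from DERIV_cdivide [OF this, of 2]
      have "((\<lambda>z. (1 / (Complex c v - (q + 2 * z))) / 2) has_field_derivative ?g u) (at (of_real u))"
        by (simp only: nonzero_mult_div_cancel_left [OF zero_neq_numeral [symmetric]])
      from has_vector_derivative_real_field [OF this, of "{\<alpha>..\<beta>}"]
      show "(?G has_vector_derivative ?g u) (at u within {\<alpha>..\<beta>})" .
    qed
    then have 1: "integral {\<alpha>..\<beta>} ?g = ?G \<beta> - ?G \<alpha>" by (rule integral_unique)
    have "set_integrable lborel ?B ?g" by (rule set_integrable_subset [OF ig]) auto
    then have "(LINT u:?B|lborel. ?g u) = integral ?B ?g" by (rule set_borel_integral_eq_integral)
    also have "\<dots> = ?G \<beta> - ?G \<alpha>"
      using 1 by (simp add: integral_open_interval_real)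
    finally have "(LINT u:?B|lborel. ?g u) = ?G \<beta> - ?G \<alpha>" .
    then have "(LINT u:?B|lborel. f (Complex c v) * ?g u) = f (Complex c v) * (?G \<beta> - ?G \<alpha>)"
      by (simp only: set_integral_mult_right)
    then show "(LINT u:?B|lborel. ?\<Psi> (u, v)) = (f (Complex c v) * (1 / (Complex c v - (q + 2 * of_real \<beta>)))
      - f (Complex c v) * (1 / (Complex c v - (q + 2 * of_real \<alpha>)))) / 2"
      by (simp only: prod.case diff_divide_distrib right_diff_distrib times_divide_eq_right)
  qed
  also have "\<dots> = (cauchy_line c (q + 2 * of_real \<beta>) - cauchy_line c (q + 2 * of_real \<alpha>)) / 2"
  proof -
    have "integrable lborel (\<lambda>v. f (Complex c v) * (1 / (Complex c v - (q + 2 * of_real \<alpha>))))"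
         "integrable lborel (\<lambda>v. f (Complex c v) * (1 / (Complex c v - (q + 2 * of_real \<beta>))))"
      using side [of \<alpha>] side [of \<beta>] \<open>\<alpha> \<le> \<beta>\<close> \<delta> by (intro integrable_cauchy_line c; auto)+
    then show ?thesis unfolding cauchy_line_def by simp
  qed
  finally show "(LINT p:(?B \<times> UNIV)|lborel. ?\<Phi> p)
      = (cauchy_line c (q + 2 * of_real \<beta>) - cauchy_line c (q + 2 * of_real \<alpha>)) / 2" .
qed

definition line_energy :: "real \<Rightarrow> real" where
  "line_energy c = (LINT v|lborel. (norm (f (Complex c v)))\<^sup>2)"

text \<open>
  The Lorentzian of width \<open>D\<close> has integral \<open>\<pi> / D\<close>, so the weight \<open>sqrt D\<close> makes the contributions
  of \<open>f\<close> and of the kernel both of order \<open>1 / sqrt D\<close>.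
\<close>
lemma norm_cauchy_line_le:
  assumes c: "L2_line c" and ne: "Re q \<noteq> c"
  shows "norm (cauchy_line c q) \<le> (line_energy c + pi) / (2 * sqrt \<bar>c - Re q\<bar>)"
proof -
  define D where "D = \<bar>c - Re q\<bar>"
  have D: "D > 0" using ne by (simp add: D_def)
  let ?b = "\<lambda>v. ((norm (f (Complex c v)))\<^sup>2 / sqrt D + sqrt D * (1 / (D\<^sup>2 + (v - Im q)\<^sup>2))) / 2"
  have i1: "integrable lborel (\<lambda>v. (norm (f (Complex c v)))\<^sup>2)" using c by (simp add: L2_line_def)
  note i2 = integrable_lorentzian [OF D, of "Im q"]
  have "norm (cauchy_line c q) \<le> (LINT v|lborel. norm (f (Complex c v) * (1 / (Complex c v - q))))"
    unfolding cauchy_line_def by (rule integral_norm_bound)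
  also have "\<dots> \<le> (LINT v|lborel. ?b v)"
  proof (rule integral_mono)
    show "integrable lborel (\<lambda>v. norm (f (Complex c v) * (1 / (Complex c v - q))))"
      using assms by (intro integrable_norm integrable_cauchy_line)
    show "integrable lborel ?b"
      by (intro integrable_divide Bochner_Integration.integrable_add integrable_mult_right i1 i2)
    show "norm (f (Complex c v) * (1 / (Complex c v - q))) \<le> ?b v" for v
      using norm_mult_le_weighted_squares [of "sqrt D" "f (Complex c v)" "1 / (Complex c v - q)"] D
      unfolding norm_sq_inverse_vertical by (simp add: D_def)
  qed
  also have "\<dots> = (line_energy c / sqrt D + sqrt D * (pi / D)) / 2"
  proof -
    have "integrable lborel (\<lambda>v. (norm (f (Complex c v)))\<^sup>2 / sqrt D)"
      "integrable lborel (\<lambda>v. sqrt D * (1 / (D\<^sup>2 + (v - Im q)\<^sup>2)))"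
      using i1 by (simp, intro integrable_mult_right i2)
    from Bochner_Integration.integral_add [OF this] show ?thesis
      by (simp only: integral_divide_zero integral_mult_right_zero integral_lorentzian [OF D] line_energy_def)
  qed
  also have "sqrt D * (pi / D) = pi / sqrt D"
    using D by (simp add: field_simps flip: power2_eq_square)
  finally show ?thesis by (simp add: D_def add_divide_distrib)
qed

lemma cauchy_line_tendsto_0:
  assumes c: "L2_line c" and q: "filterlim (\<lambda>n. \<bar>c - Re (q n)\<bar>) at_top F"
  shows "((\<lambda>n. cauchy_line c (q n)) \<longlongrightarrow> 0) F"
proof (rule Lim_null_comparison)
  have "\<forall>\<^sub>F n in F. \<bar>c - Re (q n)\<bar> > 0"
    using q unfolding filterlim_at_top_dense by blast
  then show "\<forall>\<^sub>F n in F. norm (cauchy_line c (q n)) \<le> (line_energy c + pi) / (2 * sqrt \<bar>c - Re (q n)\<bar>)"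
    by eventually_elim (rule norm_cauchy_line_le [OF c], auto)
  have "filterlim (\<lambda>n. 2 * sqrt \<bar>c - Re (q n)\<bar>) at_top F"
    by (intro filterlim_tendsto_pos_mult_at_top [OF tendsto_const] filterlim_compose [OF sqrt_at_top q]) auto
  then show "((\<lambda>n. (line_energy c + pi) / (2 * sqrt \<bar>c - Re (q n)\<bar>)) \<longlongrightarrow> 0) F"
    by (intro real_tendsto_divide_at_top [OF tendsto_const])
qed

end

section \<open>The half-plane\<close>

text \<open>
  With \<open>c1 < Re x\<close> every pole \<open>x + 2 u\<close>, \<open>u > 0\<close>, lies to the right of the lines \<open>u\<close> and \<open>c1\<close>. The
  integral over the part \<open>0 < u < n\<close> of the half-plane is therefore a difference of Cauchy integrals
  over the line \<open>c1\<close>, and its upper end point disappears as \<open>n\<close> grows.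
\<close>
theorem half_plane_reproducing:
  fixes f :: "complex \<Rightarrow> complex"
  assumes bf: "bergman_function {0<..} f" and x: "Re x > 0"
  shows "set_integrable lborel ({0<..} \<times> UNIV) (\<lambda>(u, v). f (Complex u v) * (1 / (cnj (Complex u v) + x)\<^sup>2))"
    and "(LINT p:({0<..} \<times> UNIV)|lborel. (\<lambda>(u, v). f (Complex u v) * (1 / (cnj (Complex u v) + x)\<^sup>2)) p) = pi * f x"
proof -
  interpret bergman_function "{0<..}" f by (rule bf)
  let ?\<Phi> = "\<lambda>(u, v). f (Complex u v) * (1 / (cnj (Complex u v) + x)\<^sup>2)"
  define I where "I = (LINT p:({0<..} \<times> UNIV)|lborel. ?\<Phi> p)"
  show i: "set_integrable lborel ({0<..} \<times> UNIV) ?\<Phi>"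
  proof (rule set_integrable_conjugate_kernel [where \<delta> = "Re x"])
    have "set_integrable lborel UNIV (\<lambda>u. 1 / ((Re x)\<^sup>2 + (u - 0)\<^sup>2))"
      using integrable_lorentzian [OF x, of 0] by (simp add: set_integrable_def)
    then have "set_integrable lborel {0<..} (\<lambda>u. 1 / ((Re x)\<^sup>2 + (u - 0)\<^sup>2))"
      by (rule set_integrable_subset) auto
    then show "set_integrable lborel {0<..} (\<lambda>u. 1 / (u + Re x)\<^sup>2)"
    proof (rule set_integrable_bound)
      show "set_borel_measurable lborel {0<..} (\<lambda>u. 1 / (u + Re x)\<^sup>2)"
        using x by (intro set_borel_measurable_continuous_on continuous_intros) auto
      show "AE u in lborel. u \<in> {0<..} \<longrightarrow> norm (1 / (u + Re x)\<^sup>2) \<le> norm (1 / ((Re x)\<^sup>2 + (u - 0)\<^sup>2))"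
      proof (rule AE_I2, rule impI)
        fix u :: real assume "u \<in> {0<..}"
        then have "u > 0" by simp
        then have "(Re x)\<^sup>2 + (u - 0)\<^sup>2 \<le> (u + Re x)\<^sup>2"
          using x by (simp add: power2_sum)
        moreover have "(Re x)\<^sup>2 + (u - 0)\<^sup>2 > 0"
          using x by (simp add: add_pos_nonneg)
        ultimately show "norm (1 / (u + Re x)\<^sup>2) \<le> norm (1 / ((Re x)\<^sup>2 + (u - 0)\<^sup>2))"
          by (simp add: frac_le)
      qed
    qed
  qed (use x in auto)
  obtain c1 where c1: "0 < c1" "c1 < Re x" "L2_line c1"
    by (rule ex_L2_line [OF x]) auto
  have "(\<lambda>n. (LINT p:({0<..<real n} \<times> UNIV)|lborel. ?\<Phi> p)) \<longlonglongrightarrow> I"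
  proof -
    have U: "(\<Union>n. {0<..<real n} \<times> (UNIV :: real set)) = {0<..} \<times> UNIV"
      using reals_Archimedean2 by (auto simp: set_eq_iff)
    show ?thesis unfolding I_def U [symmetric]
    proof (rule set_integral_cont_up)
      show "{0<..<real n} \<times> UNIV \<in> sets (lborel :: (real \<times> real) measure)" for n
        by (simp add: borel_Times)
      show "incseq (\<lambda>n. {0<..<real n} \<times> (UNIV :: real set))"
        by (auto simp: incseq_def)
    qed (use i U in simp)
  qed
  moreover have "(LINT p:({0<..<real n} \<times> UNIV)|lborel. ?\<Phi> p)
      = (cauchy_line c1 (x + 2 * of_real (real n)) - cauchy_line c1 (x + 2 * of_real 0)) / 2" for n
    using c1 by (intro conjugate_kernel_strip_integral(2) [where \<delta> = "Re x - c1"]) auto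
  moreover have "(\<lambda>n. (cauchy_line c1 (x + 2 * of_real (real n)) - cauchy_line c1 (x + 2 * of_real 0)) / 2)
      \<longlonglongrightarrow> (0 - cauchy_line c1 (x + 2 * of_real 0)) / 2"
  proof (intro tendsto_intros cauchy_line_tendsto_0 c1)
    have "filterlim (\<lambda>n. 2 * real n + (Re x - c1)) at_top sequentially"
      by real_asymp
    moreover have "\<bar>c1 - Re (x + 2 * of_real (real n))\<bar> = 2 * real n + (Re x - c1)" for n
      using c1 by simp
    ultimately show "filterlim (\<lambda>n. \<bar>c1 - Re (x + 2 * of_real (real n))\<bar>) at_top sequentially"
      by simp
  qed simp
  ultimately have I: "I = - cauchy_line c1 x / 2"
    using LIMSEQ_unique by (metis (no_types, lifting) LIMSEQ_unique diff_0 ext mult_zero_right of_real_0 add.right_neutral)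
  have "I = pi * f x"
  proof (rule ccontr)
    \<comment> \<open>Jumping over \<open>x\<close> shows that the defect is minus half the Cauchy integral over any line to the right of \<open>x\<close>; a far line of small energy makes it smaller than itself.\<close>
    define \<epsilon> where "\<epsilon> = norm (I - pi * f x)"
    assume "\<not> ?thesis"
    then have \<epsilon>: "\<epsilon> > 0" by (simp add: \<epsilon>_def)
    have "set_integrable lborel {0<..} line_energy"
      using integrable_vertical_lines [OF square_integrable] by (simp add: line_energy_def [abs_def])
    from integrable_not_bounded_below [OF this [unfolded set_integrable_def] zero_less_one AE_L2_line]
    obtain c2 where c2: "c2 \<ge> Re x + 1 + ((1 + pi) / \<epsilon>)\<^sup>2" "c2 > 0 \<longrightarrow> L2_line c2"
        "indicator {0<..} c2 *\<^sub>R line_energy c2 < 1"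
      by (metis greaterThan_iff)
    have gt: "Re x < c2" "0 < c2"
      using c2(1) x zero_le_power2 [of "(1 + pi) / \<epsilon>"] by linarith+
    then have g2: "L2_line c2" and e2: "line_energy c2 < 1" using c2 by auto
    have "(1 + pi) / \<epsilon> = sqrt (((1 + pi) / \<epsilon>)\<^sup>2)"
      using \<epsilon> pi_gt_zero by simp
    also have "\<dots> \<le> sqrt \<bar>c2 - Re x\<bar>" using c2(1) by (intro real_sqrt_le_mono) simp
    finally have big: "(1 + pi) / \<epsilon> \<le> sqrt \<bar>c2 - Re x\<bar>" .
    have "cauchy_line c2 x = cauchy_line c1 x + 2 * pi * f x"
      using c1 g2 gt by (intro cauchy_line_jump) auto
    then have "I - pi * f x = - (cauchy_line c2 x / 2)"
      by (simp add: I field_simps)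
    then have "2 * \<epsilon> = norm (cauchy_line c2 x)"
      by (simp add: \<epsilon>_def norm_divide)
    also have "\<dots> \<le> (line_energy c2 + pi) / (2 * sqrt \<bar>c2 - Re x\<bar>)"
      using g2 gt by (intro norm_cauchy_line_le) auto
    also have "\<dots> \<le> (1 + pi) / (2 * ((1 + pi) / \<epsilon>))"
    proof (rule frac_le)
      show "0 \<le> 1 + pi" "line_energy c2 + pi \<le> 1 + pi"
        using e2 pi_gt_zero by linarith+
      show "2 * ((1 + pi) / \<epsilon>) \<le> 2 * sqrt \<bar>c2 - Re x\<bar>"
        using big by (intro mult_left_mono) auto
      have "1 + pi > 0" using pi_gt_zero by linarith
      then show "0 < 2 * ((1 + pi) / \<epsilon>)"
        using \<epsilon> by (intro mult_pos_pos divide_pos_pos) auto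
    qed
    also have "\<dots> = \<epsilon> / 2"
    proof -
      have "y / (2 * (y / \<epsilon>)) = \<epsilon> / 2" if "y \<noteq> 0" for y :: real
        using that \<epsilon> by (simp add: field_simps)
      then show ?thesis using pi_gt_zero by (metis add_pos_pos less_irrefl zero_less_one)
    qed
    finally show False using \<epsilon> by simp
  qed
  then show "(LINT p:({0<..} \<times> UNIV)|lborel. ?\<Phi> p) = pi * f x" by (simp add: I_def)
qed

section \<open>The strip\<close>

lemma set_integral_split_point:
  fixes g :: "real \<Rightarrow> 'a :: {banach, second_countable_topology}"
  assumes g: "set_integrable lborel {a<..<b} g" and "a < m" "m < b"
  shows "(LINT u:{a<..<b}|lborel. g u) = (LINT u:{a<..<m}|lborel. g u) + (LINT u:{m<..<b}|lborel. g u)"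
proof -
  have i: "set_integrable lborel {a<..<m} g" "set_integrable lborel {m<..<b} g"
    "set_integrable lborel ({a<..<m} \<union> {m<..<b}) g"
    using assms by (auto intro!: set_integrable_subset [OF g])
  have "(LINT u:{a<..<b}|lborel. g u) = (LINT u:({a<..<m} \<union> {m<..<b})|lborel. g u)"
  proof (rule set_integral_cong_set)
    show "AE u in lborel. u \<in> {a<..<m} \<union> {m<..<b} \<longleftrightarrow> u \<in> {a<..<b}"
      using AE_lborel_singleton [of m] by eventually_elim (use assms in auto)
  qed (use i g in \<open>auto simp: set_integrable_def set_borel_measurable_def\<close>)
  also have "\<dots> = (LINT u:{a<..<m}|lborel. g u) + (LINT u:{m<..<b}|lborel. g u)"
    using i by (intro set_integral_Un) auto
  finally show ?thesis .
qed

context bergman_function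
begin

text \<open>
  The square of the kernel has integral at most \<open>d \<pi> / \<delta>\<^sup>3\<close> over the strip. The weight
  \<open>\<delta> powr (3/2)\<close> balances this against the energy of \<open>f\<close>; the resulting rate is summable when \<open>\<delta>\<close>
  runs through the multiples of a constant, which justifies integrating the kernel series termwise.
\<close>
lemma strip_kernel_norm_integral:
  fixes d \<delta> :: real
  assumes A: "A = {0<..<d}" and d: "d > 0" and \<delta>: "\<delta> > 0"
    and far: "\<And>u. u \<in> A \<Longrightarrow> \<delta> \<le> \<bar>u + Re q\<bar>"
  shows "set_integrable lborel (A \<times> UNIV) (\<lambda>(u, v). f (Complex u v) * (1 / (cnj (Complex u v) + q)\<^sup>2))"
    and "(LINT p:(A \<times> UNIV)|lborel. norm ((\<lambda>(u, v). f (Complex u v) * (1 / (cnj (Complex u v) + q)\<^sup>2)) p))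
      \<le> ((LINT p:(A \<times> UNIV)|lborel. (\<lambda>(u, v). (norm (f (Complex u v)))\<^sup>2) p) + d * pi) / 2 / \<delta> powr (3/2)"
proof -
  let ?\<Phi> = "\<lambda>(u, v). f (Complex u v) * (1 / (cnj (Complex u v) + q)\<^sup>2)"
  let ?E = "\<lambda>(u, v). (norm (f (Complex u v)))\<^sup>2"
  let ?L = "\<lambda>(u, v). (1 / \<delta>\<^sup>2) / (\<delta>\<^sup>2 + (v - Im q)\<^sup>2)"
  define r where "r = \<delta> powr (3/2)"
  have r: "r > 0" using \<delta> by (simp add: r_def)
  have rr: "r * r = \<delta> ^ 3"
  proof -
    have "r * r = \<delta> powr (3/2 + 3/2)" by (simp only: r_def powr_add)
    also have "3/2 + 3/2 = real 3" by simp
    finally show ?thesis using \<delta> by (simp only: powr_realpow)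
  qed
  have w: "set_integrable lborel A (\<lambda>u. c)" for c :: real
    unfolding A by (rule set_integrable_subset [OF borel_integrable_atLeastAtMost' [of 0 d]]) auto
  have le: "1 / (u + Re q)\<^sup>2 \<le> 1 / \<delta>\<^sup>2" if "u \<in> A" for u
  proof -
    have "\<delta>\<^sup>2 \<le> (u + Re q)\<^sup>2" using power_mono [OF far [OF that], of 2] \<delta> by simp
    then show ?thesis using \<delta> by (intro divide_left_mono) (auto simp: zero_less_mult_iff)
  qed
  show i\<Phi>: "set_integrable lborel (A \<times> UNIV) ?\<Phi>"
  proof (rule set_integrable_conjugate_kernel [OF _ _ \<delta> far])
    show "set_integrable lborel A (\<lambda>u. 1 / (u + Re q)\<^sup>2)"
    proof (rule set_integrable_bound [OF w [of "1 / \<delta>\<^sup>2"]])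
      have "continuous_on A (\<lambda>u. 1 / (u + Re q)\<^sup>2)"
        using far \<delta> by (intro continuous_intros) force
      then show "set_borel_measurable lborel A (\<lambda>u. 1 / (u + Re q)\<^sup>2)"
        using A by (intro set_borel_measurable_continuous_on) auto
      show "AE u in lborel. u \<in> A \<longrightarrow> norm (1 / (u + Re q)\<^sup>2) \<le> norm (1 / \<delta>\<^sup>2)"
        using le by (intro AE_I2) auto
    qed
  qed (use A in auto)
  have iL: "set_integrable lborel (A \<times> UNIV) ?L"
  proof -
    have "integrable lborel (\<lambda>(u, v). (indicator A u *\<^sub>R (1 / \<delta>\<^sup>2)) * (1 / (\<delta>\<^sup>2 + (v - Im q)\<^sup>2)))"
      using w [of "1 / \<delta>\<^sup>2", unfolded set_integrable_def] integrable_lorentzian [OF \<delta>]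
      by (rule integrable_prod_fun)
    then show ?thesis unfolding set_integrable_def
      by (rule back_subst [of "integrable _"]) (auto simp: fun_eq_iff indicator_def)
  qed
  have "(LINT p:(A \<times> UNIV)|lborel. ?L p) = (LINT u:A|lborel. (1 / \<delta>\<^sup>2) * (pi / \<delta>))"
  proof -
    have "(LINT v|lborel. (1 / \<delta>\<^sup>2) / (\<delta>\<^sup>2 + (v - Im q)\<^sup>2)) = (1 / \<delta>\<^sup>2) * (pi / \<delta>)"
      using integral_mult_right_zero [of lborel "1 / \<delta>\<^sup>2" "\<lambda>v. 1 / (\<delta>\<^sup>2 + (v - Im q)\<^sup>2)"]
      by (simp add: integral_lorentzian [OF \<delta>])
    then show ?thesis
      unfolding set_integral_vertical_lines [OF iL] by simp
  qed
  also have "\<dots> = d * ((1 / \<delta>\<^sup>2) * (pi / \<delta>))"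
    using d by (simp add: set_lebesgue_integral_def A)
  finally have L: "(LINT p:(A \<times> UNIV)|lborel. ?L p) = d * pi / \<delta> ^ 3"
    by (simp add: power3_eq_cube power2_eq_square)
  have "(LINT p:(A \<times> UNIV)|lborel. norm (?\<Phi> p)) \<le> (LINT p:(A \<times> UNIV)|lborel. (?E p / r + r * ?L p) / 2)"
  proof (rule set_integral_mono)
    show "set_integrable lborel (A \<times> UNIV) (\<lambda>p. norm (?\<Phi> p))"
      using i\<Phi> by (rule set_integrable_norm)
    show "set_integrable lborel (A \<times> UNIV) (\<lambda>p. (?E p / r + r * ?L p) / 2)"
      using square_integrable iL
      by (intro set_integrable_divide set_integral_add set_integrable_mult_right) auto
    fix p :: "real \<times> real" assume p: "p \<in> A \<times> UNIV"
    obtain u v where uv: "p = (u, v)" "u \<in> A" using p by auto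
    let ?z = "cnj (Complex u v) + q"
    have "(norm (1 / ?z\<^sup>2))\<^sup>2 \<le> (1 / \<delta>\<^sup>2) / (\<delta>\<^sup>2 + (v - Im q)\<^sup>2)"
      using far [OF uv(2)] \<delta> by (intro norm_sq_inverse_square_le) (auto simp: power2_commute)
    then have "(norm (1 / ?z\<^sup>2))\<^sup>2 \<le> ?L p" by (simp add: uv)
    then have "r * (norm (1 / ?z\<^sup>2))\<^sup>2 \<le> r * ?L p" using r by (intro mult_left_mono) auto
    then have "((norm (f (Complex u v)))\<^sup>2 / r + r * (norm (1 / ?z\<^sup>2))\<^sup>2) / 2 \<le> (?E p / r + r * ?L p) / 2"
      unfolding uv(1) prod.case by (intro divide_right_mono add_left_mono) auto
    with norm_mult_le_weighted_squares [OF r, of "f (Complex u v)" "1 / ?z\<^sup>2"]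
    show "norm (?\<Phi> p) \<le> (?E p / r + r * ?L p) / 2"
      unfolding uv(1) prod.case by (rule order_trans)
  qed
  also have "\<dots> = ((LINT p:(A \<times> UNIV)|lborel. ?E p) / r + r * (d * pi / \<delta> ^ 3)) / 2"
  proof -
    have "set_integrable lborel (A \<times> UNIV) (\<lambda>p. ?E p / r)"
      using square_integrable by (intro set_integrable_divide) auto
    moreover have "set_integrable lborel (A \<times> UNIV) (\<lambda>p. r * ?L p)"
      using iL by (intro set_integrable_mult_right) auto
    ultimately show ?thesis
      by (simp only: set_integral_divide_zero set_integral_add(2) set_integral_mult_right L)
  qed
  also have "r * (d * pi / \<delta> ^ 3) = d * pi / r"
    using r by (simp add: rr [symmetric])
  finally show "(LINT p:(A \<times> UNIV)|lborel. norm (?\<Phi> p))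
      \<le> ((LINT p:(A \<times> UNIV)|lborel. ?E p) + d * pi) / 2 / \<delta> powr (3/2)"
    by (simp add: r_def add_divide_distrib)
qed

end

text \<open>
  The point \<open>x\<close> is fixed throughout, so that the \<open>n\<close>-th kernel and its integral depend on \<open>n\<close> only.
\<close>
locale strip_bergman_function = bergman_function "{0<..<d}" f
  for d :: real and f +
  fixes x :: complex
  assumes d: "d > 0" and x: "0 < Re x" "Re x < d"
begin

abbreviation S :: "(real \<times> real) set" where "S \<equiv> {0<..<d} \<times> UNIV"

definition q :: "int \<Rightarrow> complex" where
  "q n = x + of_real (2 * d * of_int n)"

definition \<kappa> :: "int \<Rightarrow> real \<times> real \<Rightarrow> complex" where
  "\<kappa> n = (\<lambda>(u, v). 1 / (cnj (Complex u v) + q n)\<^sup>2)"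

definition \<Phi> :: "int \<Rightarrow> real \<times> real \<Rightarrow> complex" where
  "\<Phi> n = (\<lambda>(u, v). f (Complex u v) * (1 / (cnj (Complex u v) + q n)\<^sup>2))"

lemma \<Phi>_eq: "\<Phi> n (u, v) = f (Complex u v) * \<kappa> n (u, v)"
  by (simp add: \<Phi>_def \<kappa>_def)

lemma Re_q: "Re (q n) = Re x + 2 * d * of_int n"
  by (simp add: q_def)

lemma q_Suc: "q (n + 1) = q n + 2 * of_real d"
  by (simp add: q_def algebra_simps)

lemma Re_q_nonneg: "n \<ge> 0 \<Longrightarrow> Re (q n) \<ge> Re x"
  using d by (simp add: Re_q)

lemma Re_q_neg:
  assumes "n < 0"
  shows "Re (q n) \<le> Re x - 2 * d"
proof -
  have "real_of_int n \<le> -1" using assms by simp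
  then have "2 * d * real_of_int n \<le> 2 * d * (-1)" using d by (intro mult_left_mono) auto
  then show ?thesis by (simp add: Re_q)
qed

lemma Re_q_pos:
  assumes "n > 0"
  shows "Re (q n) \<ge> Re x + 2 * d"
proof -
  have "real_of_int n \<ge> 1" using assms by simp
  then have "2 * d * real_of_int n \<ge> 2 * d * 1" using d by (intro mult_left_mono) auto
  then show ?thesis by (simp add: Re_q)
qed

lemma set_integrable_\<Phi>: "set_integrable lborel S (\<Phi> n)"
proof -
  define \<delta> where "\<delta> = min (Re x) (d - Re x)"
  have "\<delta> > 0" using x by (simp add: \<delta>_def)
  moreover have "\<delta> \<le> \<bar>u + Re (q n)\<bar>" if "u \<in> {0<..<d}" for u
    using Re_q_nonneg [of n] Re_q_neg [of n] that x by (cases "n < 0") (auto simp: \<delta>_def)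
  ultimately show ?thesis
    unfolding \<Phi>_def by (rule strip_kernel_norm_integral(1) [OF refl d])
qed

text \<open>
  For \<open>n \<ge> 0\<close> the pole \<open>q n + 2 u\<close> lies to the right, for \<open>n < 0\<close> to the left of the lines involved:
  with \<open>Re x\<close> between \<open>c1\<close> and \<open>c2\<close>, its abscissa stays above \<open>c1\<close> or below \<open>0\<close> for \<open>u \<le> d/2\<close>,
  and above \<open>d\<close> or at most \<open>Re x\<close> for \<open>u \<ge> d/2\<close>. The two Cauchy integrals at the cut \<open>u = d/2\<close> cancel,
  because \<open>q n + d\<close> is never between the lines \<open>c1\<close> and \<open>c2\<close>.
\<close>
lemma integral_\<Phi>:
  assumes c1: "0 < c1" "c1 < Re x" "L2_line c1" and c2: "Re x < c2" "c2 < d" "L2_line c2"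
  shows "(LINT p:S|lborel. \<Phi> n p) = (cauchy_line c2 (q (n + 1)) - cauchy_line c1 (q n)) / 2"
proof -
  define \<delta> where "\<delta> = min (min (Re x - c1) (d - Re x)) (c2 - Re x)"
  have \<delta>: "\<delta> > 0" using x c1 c2 by (simp add: \<delta>_def)
  have \<delta>_le: "\<delta> \<le> Re x - c1" "\<delta> \<le> d - Re x" "\<delta> \<le> c2 - Re x"
    by (auto simp: \<delta>_def)
  have h1: "(LINT p:({0<..<d/2} \<times> UNIV)|lborel. \<Phi> n p)
    = (cauchy_line c1 (q n + 2 * of_real (d/2)) - cauchy_line c1 (q n + 2 * of_real 0)) / 2"
    unfolding \<Phi>_def
  proof (rule conjugate_kernel_strip_integral(2) [OF _ _ c1(3) \<delta>])
    fix u assume u: "u \<in> {0..d/2}"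
    show "\<delta> \<le> Re (q n) + u \<and> \<delta> \<le> Re (q n) + 2 * u - c1 \<or> Re (q n) + u \<le> - \<delta> \<and> Re (q n) + 2 * u - c1 \<le> - \<delta>"
    proof (cases "n < 0")
      case True
      then have "Re (q n) + u \<le> - \<delta>" "Re (q n) + 2 * u - c1 \<le> - \<delta>"
        using Re_q_neg [of n] u c1 c2 x \<delta>_le by simp_all
      then show ?thesis by simp
    next
      case False
      then have "\<delta> \<le> Re (q n) + u" "\<delta> \<le> Re (q n) + 2 * u - c1"
        using Re_q_nonneg [of n] u c1 c2 x \<delta>_le by simp_all
      then show ?thesis by simp
    qed
  qed (use d in auto)
  have h2: "(LINT p:({d/2<..<d} \<times> UNIV)|lborel. \<Phi> n p)
    = (cauchy_line c2 (q n + 2 * of_real d) - cauchy_line c2 (q n + 2 * of_real (d/2))) / 2"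
    unfolding \<Phi>_def
  proof (rule conjugate_kernel_strip_integral(2) [OF _ _ c2(3) \<delta>])
    fix u assume u: "u \<in> {d/2..d}"
    show "\<delta> \<le> Re (q n) + u \<and> \<delta> \<le> Re (q n) + 2 * u - c2 \<or> Re (q n) + u \<le> - \<delta> \<and> Re (q n) + 2 * u - c2 \<le> - \<delta>"
    proof (cases "n < 0")
      case True
      then have "Re (q n) + u \<le> - \<delta>" "Re (q n) + 2 * u - c2 \<le> - \<delta>"
        using Re_q_neg [of n] u c1 c2 x \<delta>_le by simp_all
      then show ?thesis by simp
    next
      case False
      then have "\<delta> \<le> Re (q n) + u" "\<delta> \<le> Re (q n) + 2 * u - c2"
        using Re_q_nonneg [of n] u c1 c2 x \<delta>_le by simp_all
      then show ?thesis by simp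
    qed
  qed (use d in auto)
  have mid: "cauchy_line c1 (q n + 2 * of_real (d/2)) = cauchy_line c2 (q n + 2 * of_real (d/2))"
  proof (rule cauchy_line_shift [OF c1(3) c2(3)])
    show "Re (q n + 2 * of_real (d/2)) < min c1 c2 \<or> max c1 c2 < Re (q n + 2 * of_real (d/2))"
      using Re_q_nonneg [of n] Re_q_neg [of n] x c1 c2 by (cases "n < 0") auto
  qed
  have sub: "set_integrable lborel (B \<times> UNIV) (\<Phi> n)" if "B \<subseteq> {0<..<d}" "B \<in> sets borel" for B
    using set_integrable_\<Phi> by (rule set_integrable_subset) (use that in \<open>auto simp: borel_Times\<close>)
  have "(LINT p:S|lborel. \<Phi> n p) = (LINT p:({0<..<d/2} \<times> UNIV)|lborel. \<Phi> n p) + (LINT p:({d/2<..<d} \<times> UNIV)|lborel. \<Phi> n p)"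
  proof -
    have s: "set_integrable lborel ({0<..<d/2} \<times> UNIV) (\<Phi> n)" "set_integrable lborel ({d/2<..<d} \<times> UNIV) (\<Phi> n)"
      using d by (auto intro!: sub)
    show ?thesis
      unfolding set_integral_vertical_lines [OF set_integrable_\<Phi> [of n]] set_integral_vertical_lines [OF s(1)]
        set_integral_vertical_lines [OF s(2)]
      by (rule set_integral_split_point [OF integrable_vertical_lines [OF set_integrable_\<Phi>]]) (use d in auto)
  qed
  also have "\<dots> = (cauchy_line c2 (q (n + 1)) - cauchy_line c1 (q n)) / 2"
  proof -
    have "(y - z) / 2 + (w - y) / 2 = (w - z) / 2" for y z w :: complex
      by (simp add: field_simps)
    then show ?thesis unfolding h1 h2 mid q_Suc of_real_0 mult_zero_right add_0_right .
  qed
  finally show ?thesis .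
qed

text \<open>
  Among the points \<open>q m\<close> only \<open>q 0 = x\<close> lies between the lines \<open>c1\<close> and \<open>c2\<close>. Written over \<open>c1\<close> alone,
  the sum telescopes in both directions and a single jump remains. Pairing \<open>n\<close> with \<open>- n - 1\<close> turns
  the two-sided series into a series over the natural numbers.
\<close>
lemma pair_integrals_sums:
  "(\<lambda>n. (LINT p:S|lborel. \<Phi> (int n) p) + (LINT p:S|lborel. \<Phi> (- int n - 1) p)) sums (pi * f x)"
proof -
  obtain c1 where c1: "0 < c1" "c1 < Re x" "L2_line c1"
    by (rule ex_L2_line [OF x(1)]) (use x in auto)
  obtain c2 where c2: "Re x < c2" "c2 < d" "L2_line c2"
    by (rule ex_L2_line [OF x(2)]) (use x in auto)
  define a where "a m = cauchy_line c1 (q m)" for m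
  have shift: "cauchy_line c2 (q m) = a m" if "m \<noteq> 0" for m
    unfolding a_def
  proof (rule cauchy_line_shift [OF c1(3) c2(3), symmetric])
    show "Re (q m) < min c1 c2 \<or> max c1 c2 < Re (q m)"
      using Re_q_neg [of m] Re_q_pos [of m] that x c1 c2 d by (cases "m < 0") auto
  qed
  have jump: "cauchy_line c2 (q 0) = a 0 + 2 * pi * f x"
    using cauchy_line_jump [OF c1(3) c2(3), of x] c1 c2 by (simp add: a_def q_def)
  have pair: "(LINT p:S|lborel. \<Phi> (int n) p) + (LINT p:S|lborel. \<Phi> (- int n - 1) p)
     = (a (int (Suc n)) / 2 - a (int n) / 2) + (a (- int n) / 2 - a (- int (Suc n)) / 2)
       + (if n = 0 then pi * f x else 0)" for n
  proof -
    have e: "int n + 1 = int (Suc n)" "- int n - 1 = - int (Suc n)" "- int (Suc n) + 1 = - int n"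
      by simp_all
    have 1: "cauchy_line c2 (q (int (Suc n))) = a (int (Suc n))"
      by (rule shift) simp
    have 2: "cauchy_line c2 (q (- int n)) = a (- int n) + (if n = 0 then 2 * pi * f x else 0)"
      using shift [of "- int n"] jump by auto
    have "(LINT p:S|lborel. \<Phi> (int n) p) + (LINT p:S|lborel. \<Phi> (- int n - 1) p)
       = (a (int (Suc n)) - a (int n)) / 2
         + (a (- int n) + (if n = 0 then 2 * pi * f x else 0) - a (- int (Suc n))) / 2"
      unfolding integral_\<Phi> [OF c1 c2] a_def [symmetric] e 1 2 ..
    also have "\<dots> = (a (int (Suc n)) / 2 - a (int n) / 2) + (a (- int n) / 2 - a (- int (Suc n)) / 2)
       + (if n = 0 then pi * f x else 0)"
      by (cases "n = 0") (simp_all only: if_True if_False add_divide_distrib diff_divide_distrib, simp_all)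
    finally show ?thesis .
  qed
  have "filterlim (\<lambda>n. 2 * d * real n - \<bar>c1 - Re x\<bar>) at_top sequentially"
    using d by real_asymp
  moreover have "s - \<bar>t\<bar> \<le> \<bar>t - s\<bar>" "s - \<bar>t\<bar> \<le> \<bar>t + s\<bar>" for s t :: real
    by linarith+
  then have "2 * d * real n - \<bar>c1 - Re x\<bar> \<le> \<bar>c1 - Re (q (int n))\<bar>"
    "2 * d * real n - \<bar>c1 - Re x\<bar> \<le> \<bar>c1 - Re (q (- int n))\<bar>" for n
    by (simp_all add: Re_q diff_diff_eq [symmetric])
  ultimately have far: "filterlim (\<lambda>n. \<bar>c1 - Re (q (int n))\<bar>) at_top sequentially"
    "filterlim (\<lambda>n. \<bar>c1 - Re (q (- int n))\<bar>) at_top sequentially"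
    by (auto intro: filterlim_at_top_mono always_eventually)
  have a0: "(\<lambda>n. a (int n)) \<longlonglongrightarrow> 0" "(\<lambda>n. a (- int n)) \<longlonglongrightarrow> 0"
    unfolding a_def using cauchy_line_tendsto_0 [OF c1(3) far(1)] cauchy_line_tendsto_0 [OF c1(3) far(2)] .
  have "(\<lambda>n. a (int n) / 2) \<longlonglongrightarrow> 0" "(\<lambda>n. a (- int n) / 2) \<longlonglongrightarrow> 0"
    using tendsto_divide_zero [OF a0(1), of 2] tendsto_divide_zero [OF a0(2), of 2] .
  from telescope_sums [OF this(1)] telescope_sums' [OF this(2)]
  have "(\<lambda>n. (a (int (Suc n)) / 2 - a (int n) / 2) + (a (- int n) / 2 - a (- int (Suc n)) / 2))
      sums ((0 - a (int 0) / 2) + (a (- int 0) / 2 - 0))"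
    by (rule sums_add)
  from sums_add [OF this, of "\<lambda>n. if n = 0 then pi * f x else 0"] sums_single [of 0 "\<lambda>_. pi * f x"]
  show ?thesis unfolding pair by simp
qed

lemma far_q:
  assumes "u \<in> {0<..<d}"
  shows "2 * d * real n \<le> \<bar>u + Re (q (int n))\<bar>" "2 * d * real n \<le> \<bar>u + Re (q (- int n - 1))\<bar>"
proof -
  show "2 * d * real n \<le> \<bar>u + Re (q (int n))\<bar>"
    using assms x d by (simp add: Re_q)
  have eq: "- (u + Re (q (- int n - 1))) = 2 * d * real n + (d - u) + (d - Re x)"
    by (simp add: Re_q algebra_simps)
  have "s \<le> \<bar>y\<bar>" if "- y = s + a + b" "0 < a" "0 < b" for s y a b :: real
    using that by linarith
  from this [OF eq] show "2 * d * real n \<le> \<bar>u + Re (q (- int n - 1))\<bar>"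
    using assms x by simp
qed

lemma \<kappa>_summable:
  assumes "u \<in> {0<..<d}"
  shows "summable (\<lambda>n. norm (\<kappa> (int n) (u, v) + \<kappa> (- int n - 1) (u, v)))"
proof -
  have inv_sq: "summable (\<lambda>n. 1 / (2 * d * real n)\<^sup>2)"
    using summable_mult [OF inverse_power_summable [of 2], of "1 / (2 * d)\<^sup>2"]
    by (simp add: field_simps)
  have \<kappa>_le: "norm (\<kappa> m (u, v)) \<le> 1 / (2 * d * real n)\<^sup>2"
    if "2 * d * real n \<le> \<bar>u + Re (q m)\<bar>" "n \<ge> 1" for m n
  proof -
    have "2 * d * real n \<le> norm (cnj (Complex u v) + q m)"
      using that abs_Re_le_cmod [of "cnj (Complex u v) + q m"] by simp
    then have "(2 * d * real n)\<^sup>2 \<le> (norm (cnj (Complex u v) + q m))\<^sup>2"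
      using d by (intro power_mono) auto
    moreover have "(2 * d * real n)\<^sup>2 > 0" using that d by simp
    ultimately show ?thesis
      unfolding \<kappa>_def by (simp add: norm_divide norm_power frac_le)
  qed
  show ?thesis
  proof (rule summable_comparison_test_ev)
    show "summable (\<lambda>n. 2 * (1 / (2 * d * real n)\<^sup>2))"
      by (intro summable_mult inv_sq)
    show "\<forall>\<^sub>F n in sequentially. norm (norm (\<kappa> (int n) (u, v) + \<kappa> (- int n - 1) (u, v))) \<le> 2 * (1 / (2 * d * real n)\<^sup>2)"
      using eventually_ge_at_top [of 1]
    proof eventually_elim
      case (elim n)
      have "norm (\<kappa> (int n) (u, v) + \<kappa> (- int n - 1) (u, v)) \<le> norm (\<kappa> (int n) (u, v)) + norm (\<kappa> (- int n - 1) (u, v))"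
        by (rule norm_triangle_ineq)
      also have "\<dots> \<le> 1 / (2 * d * real n)\<^sup>2 + 1 / (2 * d * real n)\<^sup>2"
        using \<kappa>_le [OF far_q(1) [OF assms] elim] \<kappa>_le [OF far_q(2) [OF assms] elim] by (rule add_mono)
      finally show ?case by simp
    qed
  qed
qed

text \<open>
  The kernel series, up to the factor \<open>1 / \<pi>\<close> and conjugation.
\<close>
definition K :: "real \<times> real \<Rightarrow> complex" where
  "K p = (\<Sum>n::nat. \<kappa> (int n) p + \<kappa> (- int n - 1) p)"

theorem strip_reproducing:
  shows "set_integrable lborel S (\<lambda>(u, v). f (Complex u v) * K (u, v))"
    and "(LINT p:S|lborel. (\<lambda>(u, v). f (Complex u v) * K (u, v)) p) = pi * f x"
proof -
  define T where "T n p = indicator S p *\<^sub>R (\<Phi> (int n) p + \<Phi> (- int n - 1) p)" for n p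
  have T: "integrable lborel (T n)" for n
    using set_integral_add(1) [OF set_integrable_\<Phi> set_integrable_\<Phi>] by (simp add: T_def [abs_def] set_integrable_def)
  have T_eq: "T n (u, v) = indicator S (u, v) *\<^sub>R (f (Complex u v) * (\<kappa> (int n) (u, v) + \<kappa> (- int n - 1) (u, v)))" for n u v
    by (simp add: T_def \<Phi>_eq algebra_simps)
  have T_sum: "(\<Sum>n. T n p) = indicator S p *\<^sub>R (\<lambda>(u, v). f (Complex u v) * K (u, v)) p" for p
  proof (cases p)
    case (Pair u v)
    show ?thesis
    proof (cases "u \<in> {0<..<d}")
      case True
      then show ?thesis
        using suminf_mult [OF summable_norm_cancel [OF \<kappa>_summable [OF True]], of "f (Complex u v)" v]
        unfolding Pair T_eq K_def by simp
    next
      case False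
      then show ?thesis unfolding Pair T_eq by simp
    qed
  qed
  define C where "C = ((LINT p:S|lborel. (\<lambda>(u, v). (norm (f (Complex u v)))\<^sup>2) p) + d * pi) / 2"
  have bound: "(LINT p:S|lborel. norm (\<Phi> m p)) \<le> C / (2 * d * real n) powr (3/2)"
    if "n \<ge> 1" and m: "m = int n \<or> m = - int n - 1" for m n
  proof -
    have pos: "2 * d * real n > 0" using that d by simp
    have "2 * d * real n \<le> \<bar>u + Re (q m)\<bar>" if "u \<in> {0<..<d}" for u
      using far_q [OF that, of n] m by auto
    from strip_kernel_norm_integral(2) [OF refl d pos this]
    show ?thesis unfolding \<Phi>_def C_def .
  qed
  have norms: "summable (\<lambda>n. LINT p|lborel. norm (T n p))"
  proof (rule summable_comparison_test_ev)
    have "summable (\<lambda>n. real n powr (- (3/2)))" by (subst summable_real_powr_iff) simp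
    then show "summable (\<lambda>n. (2 * C / (2 * d) powr (3/2)) * real n powr (- (3/2)))"
      by (rule summable_mult)
    show "\<forall>\<^sub>F n in sequentially. norm (LINT p|lborel. norm (T n p)) \<le> (2 * C / (2 * d) powr (3/2)) * real n powr (- (3/2))"
      using eventually_ge_at_top [of 1]
    proof eventually_elim
      case (elim n)
      have "norm (LINT p|lborel. norm (T n p)) = (LINT p|lborel. norm (T n p))"
        by simp
      also have "\<dots> \<le> (LINT p|lborel. indicator S p *\<^sub>R norm (\<Phi> (int n) p) + indicator S p *\<^sub>R norm (\<Phi> (- int n - 1) p))"
      proof (rule integral_mono)
        show "integrable lborel (\<lambda>p. norm (T n p))" using T by (rule integrable_norm)
        show "integrable lborel (\<lambda>p. indicator S p *\<^sub>R norm (\<Phi> (int n) p) + indicator S p *\<^sub>R norm (\<Phi> (- int n - 1) p))"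
          using set_integrable_norm [OF set_integrable_\<Phi>] by (intro Bochner_Integration.integrable_add) (simp_all add: set_integrable_def)
        show "norm (T n p) \<le> indicator S p *\<^sub>R norm (\<Phi> (int n) p) + indicator S p *\<^sub>R norm (\<Phi> (- int n - 1) p)" for p
          using norm_triangle_ineq [of "\<Phi> (int n) p" "\<Phi> (- int n - 1) p"] by (auto simp: T_def indicator_def)
      qed
      also have "\<dots> = (LINT p:S|lborel. norm (\<Phi> (int n) p)) + (LINT p:S|lborel. norm (\<Phi> (- int n - 1) p))"
        unfolding set_lebesgue_integral_def
        using set_integrable_norm [OF set_integrable_\<Phi>] by (intro Bochner_Integration.integral_add) (simp_all add: set_integrable_def)
      also have "\<dots> \<le> C / (2 * d * real n) powr (3/2) + C / (2 * d * real n) powr (3/2)"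
        using elim by (intro add_mono bound) auto
      also have "\<dots> = (2 * C / (2 * d) powr (3/2)) * real n powr (- (3/2))"
      proof -
        have "C / (y * z) + C / (y * z) = (2 * C / y) * inverse z" for y z :: real
          by (simp add: divide_inverse)
        then show ?thesis by (simp only: powr_mult powr_minus)
      qed
      finally show ?case .
    qed
  qed
  have AE_sum: "AE p in lborel. summable (\<lambda>n. norm (T n p))"
  proof (rule AE_I2)
    fix p :: "real \<times> real"
    obtain u v where p: "p = (u, v)" by (cases p)
    show "summable (\<lambda>n. norm (T n p))"
    proof (cases "u \<in> {0<..<d}")
      case True
      then show ?thesis
        using summable_mult [OF \<kappa>_summable [OF True], of "norm (f (Complex u v))" v]
        unfolding p T_eq by (simp add: norm_mult)
    next
      case False
      then show ?thesis unfolding p T_eq by simp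
    qed
  qed
  show "set_integrable lborel S (\<lambda>(u, v). f (Complex u v) * K (u, v))"
    using integrable_suminf [OF T AE_sum norms] unfolding T_sum set_integrable_def .
  have "(\<lambda>n. integral\<^sup>L lborel (T n)) sums (LINT p:S|lborel. (\<lambda>(u, v). f (Complex u v) * K (u, v)) p)"
    using sums_integral [OF T AE_sum norms] unfolding T_sum set_lebesgue_integral_def .
  moreover have "integral\<^sup>L lborel (T n) = (LINT p:S|lborel. \<Phi> (int n) p) + (LINT p:S|lborel. \<Phi> (- int n - 1) p)" for n
    using set_integral_add(2) [OF set_integrable_\<Phi> set_integrable_\<Phi>] by (simp add: T_def [abs_def] set_lebesgue_integral_def)
  ultimately show "(LINT p:S|lborel. (\<lambda>(u, v). f (Complex u v) * K (u, v)) p) = pi * f x"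
    using pair_integrals_sums sums_unique2 by simp
qed

end

section \<open>Octonions and the embedding of a slice\<close>

lemma octonion_distrib:
  fixes x y z :: octonion
  shows "(x + y) * z = x * z + y * z" "z * (x + y) = z * x + z * y"
    "(x - y) * z = x * z - y * z" "z * (x - y) = z * x - z * y"
    "(- x) * y = - (x * y)" "x * (- y) = - (x * y)"
  by (simp_all add: octonion_eq_iff algebra_simps)

lemma octonion_scaleR_mult:
  fixes x y :: octonion
  shows "(r *\<^sub>R x) * y = r *\<^sub>R (x * y)" "x * (r *\<^sub>R y) = r *\<^sub>R (x * y)"
  by (simp_all add: octonion_eq_iff algebra_simps)

lemma octonion_mult_1: "1 * x = (x :: octonion)" "x * 1 = (x :: octonion)"
  by (simp_all add: octonion_eq_iff)

lemma octonion_mult_0: "0 * x = (0 :: octonion)" "x * 0 = (0 :: octonion)"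
  by (simp_all add: octonion_eq_iff)

lemma octonion_power2: "x\<^sup>2 = x * (x :: octonion)"
  by (simp add: numeral_2_eq_2 octonion_mult_1)

text \<open>
  An instance of alternativity: two factors generate an associative subalgebra.
\<close>
lemma ocnj_mult_mult: "ocnj x * (x * y) = inner x x *\<^sub>R y"
  unfolding octonion_eq_iff inner_octonion_def by (intro conjI; simp; algebra)

lemma norm_ocnj: "norm (ocnj x) = norm x"
  by (simp add: norm_octonion_def inner_octonion_def)

lemma norm_octonion_inverse: "norm (inverse x) = 1 / norm (x :: octonion)"
  by (cases "x = 0") (simp_all add: inverse_octonion_def norm_ocnj power2_eq_square)

lemma norm_octonion_one: "norm (1 :: octonion) = 1"
  by (simp add: norm_octonion_def inner_octonion_def)

lemma abs_oRe_le_norm: "\<bar>oRe x\<bar> \<le> norm x"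
proof -
  have "\<bar>inner x 1\<bar> \<le> norm x * norm (1 :: octonion)" by (rule Cauchy_Schwarz_ineq2)
  then show ?thesis by (simp add: norm_octonion_one inner_octonion_def)
qed

lemma bounded_linear_octonion_mult: "bounded_linear ((*) (x :: octonion))"
  by (auto simp: octonion_distrib octonion_scaleR_mult intro!: linear_conv_bounded_linear [THEN iffD1] linearI)

text \<open>
  The isomorphism of \<open>\<complex>\<close> with the slice \<open>\<complex>\<^sub>I\<close>, so that computations on a slice take place in a field.
\<close>
definition emb :: "octonion \<Rightarrow> complex \<Rightarrow> octonion" where
  "emb I z = slice_point I (Re z) (Im z)"

lemma emb_eq: "emb I z = Re z *\<^sub>R 1 + Im z *\<^sub>R I"
  by (simp add: emb_def slice_point_def octonion_of_real_def)

lemma slice_point_emb: "slice_point I u v = emb I (Complex u v)"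
  by (simp add: emb_def)

lemma bounded_linear_emb: "bounded_linear (emb I)"
  by (auto simp: emb_eq algebra_simps intro!: linear_conv_bounded_linear [THEN iffD1] linearI)

lemmas emb_add = linear_add [OF bounded_linear.linear [OF bounded_linear_emb]]
lemmas emb_scaleR = linear_scale [OF bounded_linear.linear [OF bounded_linear_emb]]

lemma octonion_of_real_emb: "octonion_of_real r = emb I (of_real r)"
  by (simp add: emb_eq octonion_of_real_def)

lemma imaginary_sphereD:
  assumes "I \<in> imaginary_sphere"
  shows "oRe I = 0" "norm I = 1" "inner I I = 1" "ocnj I = - I"
  using assms by (auto simp: imaginary_sphere_def octonion_eq_iff norm_eq_1)

lemma unit_mult_mult:
  assumes "I \<in> imaginary_sphere"
  shows "I * (I * x) = - x"
  using ocnj_mult_mult [of I x] imaginary_sphereD [OF assms]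
  by (metis octonion_distrib(5) minus_minus scaleR_one)

text \<open>
  Only the products \<open>I (I x)\<close> occur, and these associate; the octonions are thus a vector space over
  \<open>\<complex>\<^sub>I\<close> acting from the left.
\<close>
lemma emb_mult_assoc:
  assumes "I \<in> imaginary_sphere"
  shows "emb I z * (emb I w * x) = emb I (z * w) * x"
  by (simp add: emb_eq octonion_distrib octonion_scaleR_mult octonion_mult_1 unit_mult_mult [OF assms]
      scaleR_diff_left scaleR_add_left scaleR_add_right algebra_simps)

lemma emb_mult:
  assumes "I \<in> imaginary_sphere"
  shows "emb I z * emb I w = emb I (z * w)"
  using emb_mult_assoc [OF assms, of z w 1] by (simp add: octonion_mult_1)

lemma oRe_emb: "I \<in> imaginary_sphere \<Longrightarrow> oRe (emb I z) = Re z"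
  by (simp add: emb_eq imaginary_sphereD)

lemma ocnj_emb:
  assumes "I \<in> imaginary_sphere"
  shows "ocnj (emb I z) = emb I (cnj z)"
proof -
  have "ocnj (emb I z) = Re z *\<^sub>R 1 + Im z *\<^sub>R ocnj I"
    by (simp add: emb_eq octonion_eq_iff)
  then show ?thesis by (simp add: imaginary_sphereD [OF assms] emb_eq)
qed

lemma norm_emb:
  assumes "I \<in> imaginary_sphere"
  shows "norm (emb I z) = norm z"
proof -
  have "inner 1 I = 0"
    using imaginary_sphereD [OF assms] by (simp add: inner_octonion_def)
  moreover have "inner 1 (1 :: octonion) = 1"
    by (simp add: inner_octonion_def)
  ultimately have "inner (emb I z) (emb I z) = (Re z)\<^sup>2 + (Im z)\<^sup>2"
    using imaginary_sphereD [OF assms]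
    by (simp add: emb_eq inner_add_left inner_add_right inner_commute power2_eq_square)
  then show ?thesis by (simp only: norm_octonion_def cmod_def)
qed

lemma inverse_emb:
  assumes "I \<in> imaginary_sphere"
  shows "inverse (emb I z) = emb I (inverse z)"
proof -
  have "inverse z = (1 / (norm z)\<^sup>2) *\<^sub>R cnj z"
    by (simp add: complex_eq_iff cmod_power2)
  then show ?thesis
    by (simp add: inverse_octonion_def ocnj_emb [OF assms] norm_emb [OF assms] emb_scaleR)
qed

text \<open>
  Within a slice all factors commute: the inverted factor is \<open>((y + x) (y + cnj x))\<^sup>2\<close> and the other one
  \<open>(y + x)\<^sup>2\<close>. The cancellation needs \<open>y + x \<noteq> 0\<close> because the inverse of \<open>0\<close> is \<open>0\<close>.
\<close>
lemma kernel_half_space_emb: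
  assumes I: "I \<in> imaginary_sphere" and ne: "y + x \<noteq> 0"
  shows "kernel_half_space (emb I y) (emb I x) = emb I ((1 / pi) *\<^sub>R (1 / (y + cnj x)\<^sup>2))"
proof -
  have den: "y\<^sup>2 + (2 * Re x) *\<^sub>R y + of_real ((norm x)\<^sup>2) = (y + x) * (y + cnj x)"
  proof -
    have "of_real ((norm x)\<^sup>2) = x * cnj x" by (rule complex_norm_square)
    moreover have "(2 * Re x) *\<^sub>R y = (x + cnj x) * y"
      by (simp add: complex_add_cnj scaleR_conv_of_real)
    ultimately show ?thesis by (simp add: power2_eq_square algebra_simps)
  qed
  have num: "y\<^sup>2 + 2 *\<^sub>R (y * x) + x\<^sup>2 = (y + x)\<^sup>2"
    by (simp add: power2_sum scaleR_conv_of_real)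
  have "kernel_half_space (emb I y) (emb I x)
      = emb I ((1 / pi) *\<^sub>R (inverse ((y\<^sup>2 + (2 * Re x) *\<^sub>R y + of_real ((norm x)\<^sup>2))\<^sup>2) * (y\<^sup>2 + 2 *\<^sub>R (y * x) + x\<^sup>2)))"
    unfolding kernel_half_space_def
    by (simp add: octonion_power2 emb_mult I oRe_emb norm_emb inverse_emb octonion_of_real_emb [of _ I] power2_eq_square [of "_ :: complex"]
      flip: emb_add emb_scaleR)
  also have "inverse ((y\<^sup>2 + (2 * Re x) *\<^sub>R y + of_real ((norm x)\<^sup>2))\<^sup>2) * (y\<^sup>2 + 2 *\<^sub>R (y * x) + x\<^sup>2)
      = 1 / (y + cnj x)\<^sup>2"
    unfolding den num using ne by (simp add: power_mult_distrib divide_simps)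
  finally show ?thesis .
qed

section \<open>Complex linear functionals on a slice\<close>

text \<open>
  The functional with real part \<open>inner x w\<close> that is complex linear when \<open>\<i>\<close> acts as left
  multiplication by \<open>I\<close>.
\<close>
definition slice_functional :: "octonion \<Rightarrow> octonion \<Rightarrow> octonion \<Rightarrow> complex" where
  "slice_functional I w x = Complex (inner x w) (- inner (I * x) w)"

lemma bounded_linear_slice_functional: "bounded_linear (slice_functional I w)"
  by (auto simp: slice_functional_def octonion_distrib octonion_scaleR_mult inner_add_left
      intro!: linear_conv_bounded_linear [THEN iffD1] linearI complex_eqI)

lemma slice_functional_emb_mult:
  assumes "I \<in> imaginary_sphere"
  shows "slice_functional I w (emb I z * x) = z * slice_functional I w x"
  by (simp add: slice_functional_def emb_eq octonion_distrib octonion_scaleR_mult octonion_mult_1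
      unit_mult_mult [OF assms] inner_add_left complex_eq_iff algebra_simps)

text \<open>
  Octonion-valued integrals may be tested on the functionals, since the real parts of their values
  contain all coordinates.
\<close>
lemma set_integral_by_slice_functionals:
  fixes F :: "'a \<Rightarrow> octonion"
  assumes i: "\<And>w. set_integrable M S (\<lambda>p. slice_functional I w (F p))"
    and eq: "\<And>w. (LINT p:S|M. slice_functional I w (F p)) = slice_functional I w c"
  shows "set_integrable M S F" "(LINT p:S|M. F p) = c"
proof -
  have Re: "Re (indicator S p *\<^sub>R slice_functional I w x) = inner (indicator S p *\<^sub>R x) w" for p w x
    by (simp add: slice_functional_def)
  have "integrable M (\<lambda>p. inner (indicator S p *\<^sub>R F p) w)" for w
    using integrable_Re [OF i [of w, unfolded set_integrable_def]] unfolding Re .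
  then have "integrable M (\<lambda>p. \<Sum>b\<in>Basis. inner (indicator S p *\<^sub>R F p) b *\<^sub>R b)"
    by (intro Bochner_Integration.integrable_sum integrable_scaleR_left)
  then show iF: "set_integrable M S F"
    by (simp only: euclidean_representation set_integrable_def)
  have "inner (LINT p:S|M. F p) w = inner c w" for w
  proof -
    have "inner (LINT p:S|M. F p) w = (LINT p|M. inner (indicator S p *\<^sub>R F p) w)"
      unfolding set_lebesgue_integral_def
      by (rule integral_inner_left [symmetric]) (use iF in \<open>simp add: set_integrable_def\<close>)
    also have "\<dots> = Re (LINT p:S|M. slice_functional I w (F p))"
      unfolding set_lebesgue_integral_def integral_Re [OF i [unfolded set_integrable_def], symmetric] Re ..
    also have "\<dots> = inner c w" unfolding eq by (simp add: slice_functional_def)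
    finally show ?thesis .
  qed
  then show "(LINT p:S|M. F p) = c"
    using vector_eq_rdot by blast
qed

text \<open>
  The Cauchy-Riemann equation of the slice, solved for the derivative in the direction \<open>I\<close>: the
  derivative is multiplication of a fixed octonion by the increment.
\<close>
lemma slice_monogenic_has_derivative:
  assumes f: "slice_monogenic_on \<Omega> f" and "open \<Omega>" and I: "I \<in> imaginary_sphere" and z: "emb I z \<in> \<Omega>"
  obtains E where "((\<lambda>z. f (emb I z)) has_derivative (\<lambda>h. emb I h * E)) (at z)"
proof -
  have "f differentiable (at (emb I z))"
    using f z \<open>open \<Omega>\<close> unfolding slice_monogenic_on_def differentiable_on_def
    by (metis at_within_open)
  then obtain D where D: "(f has_derivative D) (at (emb I z))"
    by (auto simp: differentiable_def)
  then have linD: "linear D" by (simp add: has_derivative_linear)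
  have u: "((\<lambda>s. f (slice_point I s (Im z))) has_vector_derivative D 1) (at (Re z))"
  proof -
    have "((\<lambda>s. slice_point I s (Im z)) has_derivative (\<lambda>s. s *\<^sub>R 1)) (at (Re z))"
      unfolding slice_point_def octonion_of_real_def by (auto intro!: derivative_eq_intros)
    from has_derivative_compose [OF this D [unfolded emb_def]] show ?thesis
      by (simp only: has_vector_derivative_def linear_scale [OF linD])
  qed
  have v: "((\<lambda>t. f (slice_point I (Re z) t)) has_vector_derivative D I) (at (Im z))"
  proof -
    have "((\<lambda>t. slice_point I (Re z) t) has_derivative (\<lambda>t. t *\<^sub>R I)) (at (Im z))"
      unfolding slice_point_def octonion_of_real_def by (auto intro!: derivative_eq_intros)
    from has_derivative_compose [OF this D [unfolded emb_def]] show ?thesis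
      by (simp only: has_vector_derivative_def linear_scale [OF linD])
  qed
  have "(1/2) *\<^sub>R (D 1 + I * D I) = 0"
    using f I z vector_derivative_at [OF u] vector_derivative_at [OF v]
    unfolding slice_monogenic_on_def emb_def by metis
  then have "I * D I = - D 1" by (simp add: eq_neg_iff_add_eq_0 add.commute)
  then have "I * (I * D I) = I * (- D 1)" by simp
  then have DI: "D I = I * D 1"
    by (simp add: unit_mult_mult [OF I] octonion_distrib)
  have "((\<lambda>z. f (emb I z)) has_derivative (\<lambda>h. D (emb I h))) (at z)"
    using has_derivative_compose [OF bounded_linear_imp_has_derivative [OF bounded_linear_emb] D] .
  moreover have "D (emb I h) = emb I h * D 1" for h
    by (simp add: emb_eq linear_add [OF linD] linear_scale [OF linD] octonion_distrib octonion_scaleR_mult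
        octonion_mult_1 DI)
  ultimately show ?thesis using that by simp
qed

lemma holomorphic_slice_functional:
  assumes I: "I \<in> imaginary_sphere"
    and F: "\<And>z. z \<in> U \<Longrightarrow> \<exists>E. (F has_derivative (\<lambda>h. emb I h * E)) (at z)"
  shows "(\<lambda>z. slice_functional I w (F z)) holomorphic_on U"
proof (rule holomorphic_onI)
  fix z assume "z \<in> U"
  then obtain E where E: "(F has_derivative (\<lambda>h. emb I h * E)) (at z)" using F by blast
  have "((\<lambda>z. slice_functional I w (F z)) has_derivative (\<lambda>h. slice_functional I w (emb I h * E))) (at z)"
    by (rule bounded_linear.has_derivative [OF bounded_linear_slice_functional E])
  then have "((\<lambda>z. slice_functional I w (F z)) has_field_derivative slice_functional I w E) (at z)"
    by (simp add: has_field_derivative_def slice_functional_emb_mult [OF I] mult.commute [of _ "slice_functional I w E"])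
  then show "(\<lambda>z. slice_functional I w (F z)) field_differentiable at z within U"
    using field_differentiable_at_within field_differentiable_def by blast
qed

section \<open>The representation formula and passage between slices\<close>

text \<open>
  The common form of the half-space and the strip; on every slice it is the same set of abscissae.
\<close>
definition slab :: "real set \<Rightarrow> octonion set" where
  "slab A = {x. oRe x \<in> A}"

lemma open_slab:
  assumes "open A"
  shows "open (slab A)"
proof -
  have "linear oRe" by (auto intro!: linearI)
  then have "continuous_on UNIV oRe"
    by (simp add: linear_continuous_on linear_linear)
  then show ?thesis
    using open_vimage [OF assms, of oRe] by (simp add: slab_def vimage_def)
qed

lemma emb_in_slab: "I \<in> imaginary_sphere \<Longrightarrow> emb I z \<in> slab A \<longleftrightarrow> Re z \<in> A"
  by (simp add: slab_def oRe_emb)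

lemma slice_region_slab: "I \<in> imaginary_sphere \<Longrightarrow> slice_region (slab A) I = A \<times> UNIV"
  by (auto simp: slice_region_def slice_point_emb emb_in_slab)

text \<open>
  Both sides are holomorphic for the complex structure given by \<open>J\<close>, the right-hand side because of
  \<open>I (I x) = - x\<close> and \<open>J (J x) = - x\<close>. On the real axis, which belongs to every slice, both are equal
  to \<open>f\<close>, and the identity theorem applies to the functionals of their difference.
\<close>
lemma representation_formula:
  assumes A: "open A" "is_interval A" and f: "slice_monogenic_on (slab A) f"
    and I: "I \<in> imaginary_sphere" and J: "J \<in> imaginary_sphere" and z: "Re z \<in> A"
  shows "f (emb J z) = (1/2) *\<^sub>R (f (emb I z) + f (emb I (cnj z)))
      + (1/2) *\<^sub>R (J * (I * (f (emb I (cnj z)) - f (emb I z))))"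
proof -
  let ?U = "{z. Re z \<in> A}"
  define H where "H z = f (emb J z) - ((1/2) *\<^sub>R (f (emb I z) + f (emb I (cnj z)))
      + (1/2) *\<^sub>R (J * (I * (f (emb I (cnj z)) - f (emb I z)))))" for z
  have openU: "open ?U" using open_vimage [OF A(1), of Re] by (simp add: vimage_def continuous_on_Re)
  have "convex ?U"
    using convex_linear_vimage [of Re A] A(2) by (simp add: vimage_def is_interval_convex_1 bounded_linear.linear [OF bounded_linear_Re])
  then have conn: "connected ?U" by (rule convex_connected)
  have der: "\<exists>E. (H has_derivative (\<lambda>h. emb J h * E)) (at z)" if "z \<in> ?U" for z
  proof -
    have "emb J z \<in> slab A" "emb I z \<in> slab A" "emb I (cnj z) \<in> slab A"
      using that I J by (auto simp: emb_in_slab)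
    then obtain EJ E E' where
      EJ: "((\<lambda>z. f (emb J z)) has_derivative (\<lambda>h. emb J h * EJ)) (at z)" and
      E: "((\<lambda>z. f (emb I z)) has_derivative (\<lambda>h. emb I h * E)) (at z)" and
      E': "((\<lambda>z. f (emb I z)) has_derivative (\<lambda>h. emb I h * E')) (at (cnj z))"
      using slice_monogenic_has_derivative [OF f open_slab [OF A(1)]] I J by metis
    have G: "((\<lambda>z. f (emb I (cnj z))) has_derivative (\<lambda>h. emb I (cnj h) * E')) (at z)"
      using has_derivative_compose [OF bounded_linear_imp_has_derivative [OF bounded_linear_cnj] E'] .
    have "(H has_derivative (\<lambda>h. emb J h * EJ - ((1/2) *\<^sub>R (emb I h * E + emb I (cnj h) * E')
       + (1/2) *\<^sub>R (J * (I * (emb I (cnj h) * E' - emb I h * E)))))) (at z)"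
      unfolding H_def
      by (intro has_derivative_diff has_derivative_add has_derivative_scaleR_right
          bounded_linear.has_derivative [OF bounded_linear_octonion_mult] EJ E G)
    moreover have "emb J h * EJ - ((1/2) *\<^sub>R (emb I h * E + emb I (cnj h) * E')
       + (1/2) *\<^sub>R (J * (I * (emb I (cnj h) * E' - emb I h * E))))
       = emb J h * (EJ - ((1/2) *\<^sub>R (E + E') + (1/2) *\<^sub>R (J * (I * (E' - E)))))" for h
      by (simp add: emb_eq octonion_distrib octonion_scaleR_mult octonion_mult_1 unit_mult_mult [OF I]
        unit_mult_mult [OF J] algebra_simps)
    ultimately show ?thesis by auto
  qed
  have "H z = 0"
  proof -
    have lim: "of_real (Re z) islimpt {w \<in> ?U. Im w = 0}"
      unfolding islimpt_approachable
    proof (intro allI impI)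
      fix e :: real assume "e > 0"
      from A(1) z obtain r where r: "r > 0" "ball (Re z) r \<subseteq> A"
        using open_contains_ball by blast
      define s where "s = min r e / 2"
      have s: "s > 0" "s < r" "s < e" using r \<open>e > 0\<close> by (auto simp: s_def)
      have "Re z + s \<in> A" using r(2) s by (auto simp: dist_real_def)
      moreover have "dist (complex_of_real (Re z + s)) (of_real (Re z)) < e"
        using s by (simp add: dist_norm)
      ultimately show "\<exists>x'\<in>{w \<in> ?U. Im w = 0}. x' \<noteq> complex_of_real (Re z) \<and> dist x' (complex_of_real (Re z)) < e"
        using s by (intro bexI [of _ "of_real (Re z + s)"]) (auto simp flip: of_real_add)
    qed
    have "slice_functional J w (H z) = 0" for w
    proof (rule analytic_continuation [OF holomorphic_slice_functional [OF J der] openU conn _ _ lim])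
      fix y assume "y \<in> {w \<in> ?U. Im w = 0}"
      then have e: "emb J y = emb I y" "cnj y = y"
        by (simp_all add: emb_eq complex_eq_iff)
      show "slice_functional J w (H y) = 0"
        unfolding H_def e by (simp add: slice_functional_def octonion_mult_0 complex_eq_iff flip: scaleR_2)
    qed (use z in auto)
    from this [of "H z"] show ?thesis by (simp add: slice_functional_def complex_eq_iff)
  qed
  then show ?thesis by (simp add: H_def)
qed

lemma set_integrable_reflect:
  fixes h :: "real \<Rightarrow> real \<Rightarrow> real"
  assumes h: "set_integrable lborel (A \<times> UNIV) (\<lambda>(u, v). h u v)"
  shows "set_integrable lborel (A \<times> UNIV) (\<lambda>(u, v). h u (- v))"
proof -
  define g where "g u v = indicator A u * h u v" for u v
  have g: "integrable (lborel \<Otimes>\<^sub>M lborel) (\<lambda>(u, v). g u v)"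
    using h by (simp add: set_integrable_def lborel_prod g_def case_prod_beta' indicator_times)
  note [measurable] = borel_measurable_integrable [OF g]
  have gn: "integrable (lborel \<Otimes>\<^sub>M lborel) (\<lambda>(u, v). norm (g u v))"
    using integrable_norm [OF g] by (simp add: case_prod_beta')
  have "integrable (lborel \<Otimes>\<^sub>M lborel) (\<lambda>(u, v). g u (- v))"
  proof (rule lborel_pair.Fubini_integrable)
    have "(\<lambda>p. (\<lambda>(u, v). g u v) (fst p, - snd p)) \<in> borel_measurable (lborel \<Otimes>\<^sub>M lborel)"
      by measurable
    then show "(\<lambda>(u, v). g u (- v)) \<in> borel_measurable (lborel \<Otimes>\<^sub>M lborel)"
      by (simp add: case_prod_beta')
    have "(LINT v|lborel. norm (g u (- v))) = (LINT v|lborel. norm (g u v))" for u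
      using lborel_integral_real_affine [of "-1" "\<lambda>v. norm (g u v)" 0] by simp
    then show "integrable lborel (\<lambda>u. LINT v|lborel. norm (case (u, v) of (u, v) \<Rightarrow> g u (- v)))"
      using lborel_pair.integrable_fst [OF gn] by simp
    show "AE u in lborel. integrable lborel (\<lambda>v. case (u, v) of (u, v) \<Rightarrow> g u (- v))"
      using lborel_pair.AE_integrable_fst [OF g]
    proof eventually_elim
      case (elim u)
      then show ?case using lborel_integrable_real_affine [of "g u" "-1" 0] by simp
    qed
  qed
  then show ?thesis
    by (simp add: set_integrable_def lborel_prod g_def case_prod_beta' indicator_times)
qed

lemma continuous_on_slice:
  assumes A: "open A" and f: "slice_monogenic_on (slab A) f" and I: "I \<in> imaginary_sphere"
  shows "continuous_on (A \<times> UNIV) (\<lambda>(u, v). f (emb I (Complex u v)))"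
proof -
  have "continuous_on (slab A) f"
    using f unfolding slice_monogenic_on_def by (blast intro: differentiable_imp_continuous_on)
  moreover have "continuous_on (A \<times> UNIV) (\<lambda>p. emb I (Complex (fst p) (snd p)))"
    by (intro bounded_linear.continuous_on [OF bounded_linear_emb] continuous_intros)
  ultimately have "continuous_on (A \<times> UNIV) (\<lambda>p. f (emb I (Complex (fst p) (snd p))))"
    by (rule continuous_on_compose2) (auto simp: emb_in_slab I)
  then show ?thesis by (simp add: case_prod_beta')
qed

text \<open>
  By the representation formula \<open>norm (f (u + J v))\<close> is at most \<open>norm (f (u + I v)) + norm (f (u - I v))\<close>,
  and reflection in the real axis preserves the measure.
\<close>
lemma slice_bergman_all_slices:
  assumes A: "open A" "is_interval A" and f: "f \<in> slice_bergman (slab A)" and J: "J \<in> imaginary_sphere"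
  shows "set_integrable lborel (A \<times> UNIV) (\<lambda>(u, v). (norm (f (emb J (Complex u v))))\<^sup>2)"
proof -
  from f have mon: "slice_monogenic_on (slab A) f" by (simp add: slice_bergman_def)
  from f obtain I where I: "I \<in> imaginary_sphere"
    and iI: "set_integrable lborel (slice_region (slab A) I) (\<lambda>(u, v). (norm (f (slice_point I u v)))\<^sup>2)"
    by (auto simp: slice_bergman_def)
  define n where "n u v = (norm (f (emb I (Complex u v))))\<^sup>2" for u v
  have 1: "set_integrable lborel (A \<times> UNIV) (\<lambda>(u, v). n u v)"
    using iI by (simp add: slice_region_slab I slice_point_emb n_def)
  note 2 = set_integrable_reflect [OF 1]
  have "set_integrable lborel (A \<times> UNIV) (\<lambda>p. 2 * ((\<lambda>(u, v). n u v) p + (\<lambda>(u, v). n u (- v)) p))"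
    by (intro set_integrable_mult_right set_integral_add 1 2)
  then show ?thesis
  proof (rule set_integrable_bound)
    have "continuous_on (A \<times> UNIV) (\<lambda>p. (norm ((\<lambda>(u, v). f (emb J (Complex u v))) p))\<^sup>2)"
      by (intro continuous_intros continuous_on_slice A mon J)
    then have "continuous_on (A \<times> UNIV) (\<lambda>(u, v). (norm (f (emb J (Complex u v))))\<^sup>2)"
      by (simp add: case_prod_beta')
    then show "set_borel_measurable lborel (A \<times> UNIV) (\<lambda>(u, v). (norm (f (emb J (Complex u v))))\<^sup>2)"
      using A by (intro set_borel_measurable_continuous_on borel_Times) auto
    show "AE p in lborel. p \<in> A \<times> UNIV \<longrightarrow> norm ((\<lambda>(u, v). (norm (f (emb J (Complex u v))))\<^sup>2) p)
        \<le> norm (2 * ((\<lambda>(u, v). n u v) p + (\<lambda>(u, v). n u (- v)) p))"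
    proof (rule AE_I2, clarify)
      fix u v assume "u \<in> A"
      let ?F = "f (emb I (Complex u v))" and ?G = "f (emb I (Complex u (- v)))"
      have nI: "norm (J * (I * x)) = norm x" for x
        by (simp add: octonion_norm_mult imaginary_sphereD I J)
      have "f (emb J (Complex u v)) = (1/2) *\<^sub>R (?F + ?G) + (1/2) *\<^sub>R (J * (I * (?G - ?F)))"
        using representation_formula [OF A mon I J, of "Complex u v"] \<open>u \<in> A\<close> by (simp add: complex_cnj)
      then have "norm (f (emb J (Complex u v))) \<le> norm ((1/2) *\<^sub>R (?F + ?G)) + norm ((1/2) *\<^sub>R (J * (I * (?G - ?F))))"
        by (metis norm_triangle_ineq)
      also have "\<dots> = (norm (?F + ?G) + norm (?G - ?F)) / 2"
        by (simp add: nI)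
      also have "\<dots> \<le> ((norm ?F + norm ?G) + (norm ?G + norm ?F)) / 2"
        by (intro divide_right_mono add_mono norm_triangle_ineq norm_triangle_ineq4) auto
      finally have "norm (f (emb J (Complex u v))) \<le> norm ?F + norm ?G" by simp
      then have "(norm (f (emb J (Complex u v))))\<^sup>2 \<le> (norm ?F + norm ?G)\<^sup>2"
        by (intro power_mono) auto
      also have "\<dots> \<le> 2 * (n u v + n u (- v))"
        using sum_squares_bound [of "norm ?F" "norm ?G"] by (simp add: n_def power2_sum)
      finally show "norm ((norm (f (emb J (Complex u v))))\<^sup>2) \<le> norm (2 * (n u v + n u (- v)))"
        by (simp add: n_def)
    qed
  qed
qed

lemma bergman_function_slice_functional:
  assumes A: "open A" "is_interval A" and f: "f \<in> slice_bergman (slab A)" and I: "I \<in> imaginary_sphere"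
  shows "bergman_function A (\<lambda>z. slice_functional I w (f (emb I z)))"
proof
  from f have mon: "slice_monogenic_on (slab A) f" by (simp add: slice_bergman_def)
  show hol: "(\<lambda>z. slice_functional I w (f (emb I z))) holomorphic_on {z. Re z \<in> A}"
  proof (rule holomorphic_slice_functional [OF I])
    fix z assume "z \<in> {z. Re z \<in> A}"
    then have "emb I z \<in> slab A" by (simp add: emb_in_slab I)
    then show "\<exists>E. ((\<lambda>z. f (emb I z)) has_derivative (\<lambda>h. emb I h * E)) (at z)"
      using slice_monogenic_has_derivative [OF mon open_slab [OF A(1)] I] by metis
  qed
  obtain K where K: "norm (slice_functional I w x) \<le> norm x * K" for x
    using bounded_linear.bounded [OF bounded_linear_slice_functional] by blast
  have "set_integrable lborel (A \<times> UNIV) (\<lambda>p. K\<^sup>2 * (\<lambda>(u, v). (norm (f (emb I (Complex u v))))\<^sup>2) p)"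
    by (intro set_integrable_mult_right slice_bergman_all_slices A f I)
  then show "set_integrable lborel (A \<times> UNIV) (\<lambda>(u, v). (norm (slice_functional I w (f (emb I (Complex u v)))))\<^sup>2)"
  proof (rule set_integrable_bound)
    have "continuous_on (A \<times> UNIV) (\<lambda>p. (norm (slice_functional I w ((\<lambda>(u, v). f (emb I (Complex u v))) p)))\<^sup>2)"
      by (intro continuous_intros bounded_linear.continuous_on [OF bounded_linear_slice_functional]
          continuous_on_slice A mon I)
    then have "continuous_on (A \<times> UNIV) (\<lambda>(u, v). (norm (slice_functional I w (f (emb I (Complex u v)))))\<^sup>2)"
      by (simp add: case_prod_beta')
    then show "set_borel_measurable lborel (A \<times> UNIV) (\<lambda>(u, v). (norm (slice_functional I w (f (emb I (Complex u v)))))\<^sup>2)"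
      using A by (intro set_borel_measurable_continuous_on borel_Times) auto
    show "AE p in lborel. p \<in> A \<times> UNIV \<longrightarrow> norm ((\<lambda>(u, v). (norm (slice_functional I w (f (emb I (Complex u v)))))\<^sup>2) p)
        \<le> norm (K\<^sup>2 * (\<lambda>(u, v). (norm (f (emb I (Complex u v))))\<^sup>2) p)"
    proof (rule AE_I2, clarify)
      fix u v
      have "(norm (slice_functional I w (f (emb I (Complex u v)))))\<^sup>2 \<le> (norm (f (emb I (Complex u v))) * K)\<^sup>2"
        using K by (intro power_mono) auto
      then show "norm ((norm (slice_functional I w (f (emb I (Complex u v)))))\<^sup>2) \<le> norm (K\<^sup>2 * (norm (f (emb I (Complex u v))))\<^sup>2)"
        by (simp add: power_mult_distrib mult.commute)
    qed
  qed
qed (use A in auto)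

section \<open>From scalar to octonionic reproducing formulas\<close>

text \<open>
  Multiplying \<open>f\<close> from the left by the conjugated kernel, an element of \<open>\<complex>\<^sub>I\<close>, multiplies its
  functionals by a complex number. Hence a scalar reproducing formula with the kernel \<open>k x\<close> implies the
  octonionic one.
\<close>
lemma reproducing_kernel_slab:
  fixes k :: "complex \<Rightarrow> real \<times> real \<Rightarrow> complex"
  assumes A: "open A" "is_interval A"
    and kernel: "\<And>I y x. \<lbrakk>I \<in> imaginary_sphere; Re y \<in> A; Re x \<in> A\<rbrakk> \<Longrightarrow>
      B (emb I y) (emb I x) = emb I ((1 / pi) *\<^sub>R cnj (k x (Re y, Im y)))"
    and repr: "\<And>(g :: complex \<Rightarrow> complex) x. \<lbrakk>bergman_function A g; Re x \<in> A\<rbrakk> \<Longrightarrow>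
      set_integrable lborel (A \<times> UNIV) (\<lambda>(u, v). g (Complex u v) * k x (u, v)) \<and>
      (LINT p:(A \<times> UNIV)|lborel. (\<lambda>(u, v). g (Complex u v) * k x (u, v)) p) = pi * g x"
  shows "reproducing_kernel (slab A) B"
  unfolding reproducing_kernel_def
proof (intro ballI)
  fix f I x0
  assume f: "f \<in> slice_bergman (slab A)" and I: "I \<in> imaginary_sphere" and "x0 \<in> slab A \<inter> slice_plane I"
  then obtain x where x0: "x0 = emb I x" and x: "Re x \<in> A"
    by (auto simp: slice_plane_def slice_point_emb emb_in_slab)
  let ?F = "\<lambda>(u, v). ocnj (B (slice_point I u v) x0) * f (slice_point I u v)"
  have F: "slice_functional I w (?F p) = of_real (1 / pi) * (\<lambda>(u, v). slice_functional I w (f (emb I (Complex u v))) * k x (u, v)) p"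
    if "p \<in> A \<times> UNIV" for p w
  proof -
    from that obtain u v where p: "p = (u, v)" "u \<in> A" by auto
    have "B (slice_point I u v) x0 = emb I ((1 / pi) *\<^sub>R cnj (k x (u, v)))"
      using kernel [OF I, of "Complex u v" x] x p by (simp add: slice_point_emb x0)
    then show ?thesis
      by (simp add: p ocnj_emb I slice_functional_emb_mult slice_point_emb scaleR_conv_of_real)
  qed
  have meas: "A \<times> UNIV \<in> sets (lborel :: (real \<times> real) measure)"
    using A by (simp add: borel_Times)
  have 1: "set_integrable lborel (A \<times> UNIV) (\<lambda>p. slice_functional I w (?F p))
    \<and> (LINT p:(A \<times> UNIV)|lborel. slice_functional I w (?F p)) = slice_functional I w (f x0)" for w
  proof -
    have g: "bergman_function A (\<lambda>z. slice_functional I w (f (emb I z)))"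
      by (intro bergman_function_slice_functional A f I)
    let ?G = "\<lambda>(u, v). slice_functional I w (f (emb I (Complex u v))) * k x (u, v)"
    have "set_integrable lborel (A \<times> UNIV) (\<lambda>p. of_real (1 / pi) * ?G p)"
      using repr [OF g x] by (intro set_integrable_mult_right) auto
    then have "set_integrable lborel (A \<times> UNIV) (\<lambda>p. slice_functional I w (?F p))"
      by (rule set_integrable_cong [THEN iffD1, rotated -1]) (auto simp: F)
    moreover have "(LINT p:(A \<times> UNIV)|lborel. slice_functional I w (?F p)) = (LINT p:(A \<times> UNIV)|lborel. of_real (1 / pi) * ?G p)"
      using meas by (intro set_lebesgue_integral_cong) (auto simp: F)
    moreover have "\<dots> = of_real (1 / pi) * (pi * slice_functional I w (f x0))"
      using repr [OF g x] by (simp only: set_integral_mult_right x0)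
    ultimately show ?thesis by simp
  qed
  have "set_integrable lborel (A \<times> UNIV) ?F" "(LINT p:(A \<times> UNIV)|lborel. ?F p) = f x0"
    using 1 by (intro set_integral_by_slice_functionals [where I = I]; blast)+
  then show "slice_inner_integrable (slab A) I f (\<lambda>y. B y x0) \<and> slice_inner (slab A) I f (\<lambda>y. B y x0) = f x0"
    by (simp add: slice_inner_integrable_def slice_inner_def slice_region_slab I)
qed

lemma half_space_slab: "half_space = slab {0<..}"
  by (simp add: half_space_def slab_def)

lemma strip_slab: "strip d = slab {0<..<d}"
  by (simp add: strip_def slab_def)

lemma reproducing_kernel_half_space: "reproducing_kernel half_space kernel_half_space"
  unfolding half_space_slab
proof (rule reproducing_kernel_slab [where k = "\<lambda>x (u, v). 1 / (cnj (Complex u v) + x)\<^sup>2"])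
  fix I y x assume I: "I \<in> imaginary_sphere" and "Re y \<in> {0<..}" "Re x \<in> {0<..}"
  then have "y + x \<noteq> 0" by (auto simp: complex_eq_iff)
  from kernel_half_space_emb [OF I this]
  show "kernel_half_space (emb I y) (emb I x) = emb I ((1 / pi) *\<^sub>R cnj (case (Re y, Im y) of (u, v) \<Rightarrow> 1 / (cnj (Complex u v) + x)\<^sup>2))"
    by simp
next
  fix g :: "complex \<Rightarrow> complex" and x assume "bergman_function {0<..} g" "Re x \<in> {0<..}"
  with half_plane_reproducing [of g x]
  show "set_integrable lborel ({0<..} \<times> UNIV) (\<lambda>(u, v). g (Complex u v) * (case (u, v) of (u, v) \<Rightarrow> 1 / (cnj (Complex u v) + x)\<^sup>2)) \<and>
    (LINT p:({0<..} \<times> UNIV)|lborel. (\<lambda>(u, v). g (Complex u v) * (case (u, v) of (u, v) \<Rightarrow> 1 / (cnj (Complex u v) + x)\<^sup>2)) p) = pi * g x"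
    by simp
qed auto

section \<open>The kernel series of the strip\<close>

lemma int_split_nonneg_neg:
  "range int \<union> range (\<lambda>n. - int n - 1) = UNIV" "range int \<inter> range (\<lambda>n. - int n - 1) = {}"
proof -
  have "k \<in> range int \<union> range (\<lambda>n. - int n - 1)" for k
  proof (cases "k \<ge> 0")
    case True
    then have "k = int (nat k)" by simp
    then show ?thesis by blast
  next
    case False
    then have "k = - int (nat (- k - 1)) - 1" by simp
    then show ?thesis by blast
  qed
  then show "range int \<union> range (\<lambda>n. - int n - 1) = UNIV" by auto
  show "range int \<inter> range (\<lambda>n. - int n - 1) = {}" by auto
qed

lemma has_sum_int_pairs:
  fixes g :: "int \<Rightarrow> 'a :: banach"
  assumes "g summable_on UNIV"
  shows "(g has_sum (\<Sum>n::nat. g (int n) + g (- int n - 1))) UNIV"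
proof -
  have "g summable_on range int" "g summable_on range (\<lambda>n. - int n - 1)"
    using summable_on_subset_banach [OF assms] by auto
  then obtain a b where ab: "(g has_sum a) (range int)" "(g has_sum b) (range (\<lambda>n. - int n - 1))"
    by (auto simp: summable_on_def)
  have "((\<lambda>n. g (int n)) has_sum a) UNIV"
    using ab(1) by (subst (asm) has_sum_reindex) (auto simp: inj_on_def o_def)
  then have a: "(\<lambda>n. g (int n)) sums a" by (rule has_sum_imp_sums)
  have "((\<lambda>n. g (- int n - 1)) has_sum b) UNIV"
    using ab(2) by (subst (asm) has_sum_reindex) (auto simp: inj_on_def o_def)
  then have b: "(\<lambda>n. g (- int n - 1)) sums b" by (rule has_sum_imp_sums)
  have "(\<Sum>n. g (int n) + g (- int n - 1)) = a + b"
    using sums_unique [OF sums_add [OF a b]] by simp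
  with has_sum_Un_disjoint [OF ab int_split_nonneg_neg(2)] show ?thesis
    by (simp add: int_split_nonneg_neg(1))
qed

lemma summable_on_int_pairs:
  fixes g :: "int \<Rightarrow> 'a :: banach"
  assumes "summable (\<lambda>n. norm (g (int n)))" "summable (\<lambda>n. norm (g (- int n - 1)))"
  shows "g summable_on UNIV"
proof -
  have "g summable_on range int"
    using norm_summable_imp_summable_on [OF assms(1)]
    by (subst summable_on_reindex) (auto simp: inj_on_def o_def)
  moreover have "g summable_on range (\<lambda>n. - int n - 1)"
    using norm_summable_imp_summable_on [OF assms(2)]
    by (subst summable_on_reindex) (auto simp: inj_on_def o_def)
  ultimately show ?thesis
    using summable_on_Un_disjoint [OF _ _ int_split_nonneg_neg(2)] by (simp add: int_split_nonneg_neg(1))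
qed

text \<open>
  Here \<open>x\<close> and \<open>y\<close> need not lie on a common slice, so the kernel does not simplify. Once \<open>N\<close> dominates
  both, the inverted factor is the inverse square of a quantity of order \<open>N\<^sup>2\<close> and the other
  factor is itself of order \<open>N\<^sup>2\<close>.
\<close>
lemma norm_kernel_half_space_translate_le:
  fixes x y :: octonion and N :: real
  assumes N: "8 * (norm x + norm y) \<le> \<bar>N\<bar>" "N \<noteq> 0"
  shows "norm (kernel_half_space x (octonion_of_real N + y)) \<le> 64 / N\<^sup>2"
proof -
  define M where "M = \<bar>N\<bar>"
  have M: "M > 0" "8 * (norm x + norm y) \<le> M" using N by (auto simp: M_def)
  define y' where "y' = octonion_of_real N + y"
  have nN: "norm (octonion_of_real N) = M"
    by (simp add: octonion_of_real_def norm_octonion_one M_def)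
  \<comment> \<open>Each of \<open>x\<close>, \<open>y\<close> has norm at most \<open>M / 8\<close>, so the norm of \<open>P\<close> is at least \<open>30/64\<close> of \<open>M\<^sup>2\<close>.\<close>
  have "8 * norm x + 8 * norm y \<le> M" using M by (simp add: distrib_left)
  then have x: "norm x \<le> M / 8" and y: "norm y \<le> M / 8"
    using norm_ge_zero [of x] norm_ge_zero [of y] by linarith+
  have y'_le: "norm y' \<le> 9/8 * M"
    using norm_triangle_ineq [of "octonion_of_real N" y] nN y unfolding y'_def by linarith
  have y'_ge: "norm y' \<ge> 7/8 * M"
    using norm_diff_ineq [of "octonion_of_real N" y] nN y unfolding y'_def by linarith
  define P where "P = x\<^sup>2 + (2 * oRe y') *\<^sub>R x + octonion_of_real ((norm y')\<^sup>2)"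
  define Q where "Q = x\<^sup>2 + 2 *\<^sub>R (x * y') + y'\<^sup>2"
  have sq: "norm (z\<^sup>2) = (norm z)\<^sup>2" for z :: octonion
    by (simp add: octonion_power2 octonion_norm_mult power2_eq_square)
  have P_ge: "norm P \<ge> M\<^sup>2 / 4"
  proof -
    have a: "norm (octonion_of_real ((norm y')\<^sup>2)) = (norm y')\<^sup>2"
      by (simp add: octonion_of_real_def norm_octonion_one)
    have b: "norm (x\<^sup>2 + (2 * oRe y') *\<^sub>R x) \<le> (M / 8)\<^sup>2 + 2 * (9/8 * M) * (M / 8)"
    proof -
      have "norm (x\<^sup>2 + (2 * oRe y') *\<^sub>R x) \<le> (norm x)\<^sup>2 + 2 * \<bar>oRe y'\<bar> * norm x"
        using norm_triangle_ineq [of "x\<^sup>2" "(2 * oRe y') *\<^sub>R x"] by (simp add: sq abs_mult)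
      also have "\<dots> \<le> (M / 8)\<^sup>2 + 2 * (9/8 * M) * (M / 8)"
        using x y'_le abs_oRe_le_norm [of y'] M by (intro add_mono power_mono mult_mono) auto
      finally show ?thesis .
    qed
    have c: "(7/8 * M)\<^sup>2 \<le> (norm y')\<^sup>2"
      using y'_ge M by (intro power_mono) auto
    have "norm P \<ge> norm (octonion_of_real ((norm y')\<^sup>2)) - norm (x\<^sup>2 + (2 * oRe y') *\<^sub>R x)"
      unfolding P_def by (metis add.commute norm_diff_ineq)
    then have "norm P \<ge> (7/8 * M)\<^sup>2 - ((M / 8)\<^sup>2 + 2 * (9/8 * M) * (M / 8))"
      using a b c by linarith
    moreover have "(7/8 * M)\<^sup>2 - ((M / 8)\<^sup>2 + 2 * (9/8 * M) * (M / 8)) = 30/64 * M\<^sup>2"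
      by (simp add: power2_eq_square field_simps)
    ultimately show ?thesis using zero_le_power2 [of M] by linarith
  qed
  have Q_le: "norm Q \<le> 4 * M\<^sup>2"
  proof -
    have "norm Q \<le> norm (x\<^sup>2) + norm (2 *\<^sub>R (x * y')) + norm (y'\<^sup>2)"
      unfolding Q_def by (meson add_mono norm_triangle_ineq order_refl order_trans)
    also have "\<dots> = (norm x + norm y')\<^sup>2"
      by (simp add: sq octonion_norm_mult power2_sum)
    also have "\<dots> \<le> (2 * M)\<^sup>2"
      using x y'_le M by (intro power_mono) auto
    finally show ?thesis by (simp add: power_mult_distrib)
  qed
  have "norm (inverse (P\<^sup>2)) = 1 / (norm P)\<^sup>2"
    by (simp add: norm_octonion_inverse sq)
  also have "\<dots> \<le> 1 / (M\<^sup>2 / 4)\<^sup>2"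
    using P_ge M by (intro divide_left_mono power_mono mult_pos_pos zero_less_power) (auto intro: less_le_trans [of 0 "M\<^sup>2 / 4"])
  finally have inv: "norm (inverse (P\<^sup>2)) \<le> 1 / (M\<^sup>2 / 4)\<^sup>2" .
  have "norm (kernel_half_space x y') = (1 / pi) * (norm (inverse (P\<^sup>2)) * norm Q)"
    by (simp add: kernel_half_space_def P_def Q_def octonion_norm_mult)
  also have "\<dots> \<le> 1 * ((1 / (M\<^sup>2 / 4)\<^sup>2) * (4 * M\<^sup>2))"
    using pi_gt3 inv Q_le by (intro mult_mono) auto
  also have "\<dots> = 64 / M\<^sup>2"
    using M by (simp add: power2_eq_square field_simps)
  finally show ?thesis by (simp add: y'_def M_def)
qed

lemma kernel_strip_term_summable:
  assumes d: "d > 0"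
  shows "kernel_strip_term d x y summable_on UNIV"
proof (rule summable_on_int_pairs)
  let ?s = "\<lambda>n. 64 / (2 * d)\<^sup>2 * inverse (real n ^ 2)"
  have s: "summable ?s" by (intro summable_mult inverse_power_summable) auto
  have le: "norm (kernel_strip_term d x y m) \<le> ?s n"
    if n: "n \<ge> 1" "8 * (norm x + norm y) \<le> 2 * d * real n" and m: "real n \<le> \<bar>real_of_int m\<bar>" for n m
  proof -
    have big: "2 * d * real n \<le> \<bar>2 * d * real_of_int m\<bar>"
      using m d by (simp add: abs_mult)
    have pos: "2 * d * real n > 0" using d n by simp
    have "norm (kernel_strip_term d x y m) \<le> 64 / (2 * d * real_of_int m)\<^sup>2"
      unfolding kernel_strip_term_def
      using n(2) big pos by (intro norm_kernel_half_space_translate_le) auto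
    also have "\<dots> \<le> 64 / (2 * d * real n)\<^sup>2"
    proof -
      have "(2 * d * real n)\<^sup>2 \<le> (2 * d * real_of_int m)\<^sup>2"
        using power_mono [OF big, of 2] pos by simp
      moreover have "(2 * d * real n)\<^sup>2 > 0" using pos by (rule zero_less_power)
      ultimately show ?thesis by (intro frac_le) auto
    qed
    also have "\<dots> = ?s n"
      by (simp only: power_mult_distrib divide_inverse inverse_mult_distrib mult.assoc)
    finally show ?thesis .
  qed
  have "filterlim (\<lambda>n. 2 * d * real n) at_top sequentially"
    using d by real_asymp
  then have "\<forall>\<^sub>F n in sequentially. 8 * (norm x + norm y) \<le> 2 * d * real n"
    by (auto simp: filterlim_at_top)
  then have ev: "\<forall>\<^sub>F n in sequentially. 1 \<le> n \<and> 8 * (norm x + norm y) \<le> 2 * d * real n"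
    using eventually_ge_at_top [of 1] by eventually_elim auto
  show "summable (\<lambda>n. norm (kernel_strip_term d x y (int n)))"
  proof (rule summable_comparison_test_ev [OF _ s])
    show "\<forall>\<^sub>F n in sequentially. norm (norm (kernel_strip_term d x y (int n))) \<le> ?s n"
      using ev by eventually_elim (use le in auto)
  qed
  show "summable (\<lambda>n. norm (kernel_strip_term d x y (- int n - 1)))"
  proof (rule summable_comparison_test_ev [OF _ s])
    show "\<forall>\<^sub>F n in sequentially. norm (norm (kernel_strip_term d x y (- int n - 1))) \<le> ?s n"
      using ev by eventually_elim (use le in auto)
  qed
qed

text \<open>
  The kernel series sums the kernels of the half-space at the translates \<open>x + 2 d n\<close>, all of which lie on
  the slice of \<open>x\<close>; conjugation and the embedding of \<open>\<complex>\<close> pass through the sum.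
\<close>
lemma reproducing_kernel_strip:
  assumes d: "d > 0"
  shows "reproducing_kernel (strip d) (kernel_strip d)"
  unfolding strip_slab
proof (rule reproducing_kernel_slab [where k = "strip_bergman_function.K d"])
  fix I y x assume I: "I \<in> imaginary_sphere" and y: "Re y \<in> {0<..<d}" and x: "Re x \<in> {0<..<d}"
  \<comment> \<open>The zero function gives access to the summability of the kernels, which is a fact of the locale.\<close>
  have "bergman_function {0<..<d} (\<lambda>z. 0)"
    by standard (auto simp: set_integrable_def case_prod_beta' is_interval_1)
  then interpret strip_bergman_function d "\<lambda>z. 0" x
    using d x by (intro strip_bergman_function.intro strip_bergman_function_axioms.intro) auto
  define L where "L z = emb I ((1 / pi) *\<^sub>R cnj z)" for z
  have L: "bounded_linear L"
    unfolding L_def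
    by (intro bounded_linear_compose [OF bounded_linear_emb] bounded_linear_compose [OF bounded_linear_scaleR_right]
        bounded_linear_cnj)
  have t: "kernel_strip_term d (emb I y) (emb I x) n = L (\<kappa> n (Re y, Im y))" for n
  proof -
    have qn: "octonion_of_real (2 * d * of_int n) + emb I x = emb I (q n)"
      by (simp add: octonion_of_real_emb [of _ I] q_def add.commute flip: emb_add)
    have "y + q n \<noteq> 0"
      using Re_q_nonneg [of n] Re_q_neg [of n] x y by (cases "n < 0") (auto simp: complex_eq_iff)
    from kernel_half_space_emb [OF I this] show ?thesis
      unfolding kernel_strip_term_def qn L_def \<kappa>_def by simp
  qed
  have "kernel_strip d (emb I y) (emb I x)
     = (\<Sum>n::nat. L (\<kappa> (int n) (Re y, Im y)) + L (\<kappa> (- int n - 1) (Re y, Im y)))"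
    unfolding kernel_strip_def
    using infsumI [OF has_sum_int_pairs [OF kernel_strip_term_summable [OF d, of "emb I y" "emb I x"]]]
    by (simp add: t)
  also have "\<dots> = L (\<Sum>n::nat. \<kappa> (int n) (Re y, Im y) + \<kappa> (- int n - 1) (Re y, Im y))"
    using bounded_linear.suminf [OF L summable_norm_cancel [OF \<kappa>_summable [OF y, of "Im y"]]]
    by (simp add: linear_add [OF bounded_linear.linear [OF L]])
  finally show "kernel_strip d (emb I y) (emb I x) = emb I ((1 / pi) *\<^sub>R cnj (K (Re y, Im y)))"
    by (simp add: L_def K_def)
next
  fix g :: "complex \<Rightarrow> complex" and x assume "bergman_function {0<..<d} g" "Re x \<in> {0<..<d}"
  then interpret strip_bergman_function d g x
    using d by (intro strip_bergman_function.intro strip_bergman_function_axioms.intro) auto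
  show "set_integrable lborel ({0<..<d} \<times> UNIV) (\<lambda>(u, v). g (Complex u v) * K (u, v)) \<and>
    (LINT p:({0<..<d} \<times> UNIV)|lborel. (\<lambda>(u, v). g (Complex u v) * K (u, v)) p) = pi * g x"
    using strip_reproducing by blast
qed (auto simp: is_interval_1)

theorem proposition4p21:
  shows "reproducing_kernel half_space kernel_half_space \<and>
    (\<forall>d::real. 0 < d \<longrightarrow>
       (\<forall>x\<in>strip d. \<forall>y\<in>strip d. kernel_strip_term d x y summable_on UNIV) \<and>
       reproducing_kernel (strip d) (kernel_strip d))"
  using reproducing_kernel_half_space kernel_strip_term_summable reproducing_kernel_strip by blast

end
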